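(* Let $\mathbb T^n=\mathbb R^n/\mathbb Z^n$ be the $n$-torus and let $N\subseteq\mathbb T^n$ be the kernel of an isogeny of $\mathbb T^n$, i.e. of a surjective homomorphism $\mathbb T^n\to\mathbb T^n$ with finite kernel. Then the inclusion $N\subseteq\mathbb T^n$ is orthogonally final.
   Context: The inclusion $i\colon N\subseteq G$ of a normal (closed) subgroup of a compact Lie group is called orthogonally final if for every orthogonal $N$-representation $W$ there is an orthogonal $G$-representation $V$ and an $N$-linear isometric embedding $W\to i^*V$ inducing an isomorphism $W^N\cong(i^*V)^N$ on $N$-fixed spaces. Orthogonal representations are finite dimensional real inner product spaces with continuous action by linear isometries. *)

theory Defs
  imports "HOL-Analysis.Analysis" "HOL-Algebra.Group_Action"
begin

text \<open>
  The space \<open>\<real>\<^sup>\<infinity>\<close> of finitely supported real sequences with the standard inner product.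
  Every finite-dimensional real inner product space is isometric to a subspace of it
  (lemma \<open>isometric_embedding_fin_seq\<close>), so quantifying existentially over finite-dimensional
  subspaces of \<open>\<real>\<^sup>\<infinity>\<close> is quantifying over all finite-dimensional inner product spaces, up to
  isometry. A statement in HOL cannot quantify existentially over types.
\<close>

typedef fin_seq = "{x :: nat \<Rightarrow> real. finite {i. x i \<noteq> 0}}"
  morphisms coord Fin_seq
  by (rule exI[of _ "\<lambda>_. 0"]) simp

setup_lifting type_definition_fin_seq

instantiation fin_seq :: real_vector
begin

lift_definition zero_fin_seq :: fin_seq is "\<lambda>_. 0" by simp

lift_definition plus_fin_seq :: "fin_seq \<Rightarrow> fin_seq \<Rightarrow> fin_seq" is "\<lambda>x y i. x i + y i"
  subgoal for x y by (rule finite_subset[of _ "{i. x i \<noteq> 0} \<union> {i. y i \<noteq> 0}"]) auto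
  done

lift_definition minus_fin_seq :: "fin_seq \<Rightarrow> fin_seq \<Rightarrow> fin_seq" is "\<lambda>x y i. x i - y i"
  subgoal for x y by (rule finite_subset[of _ "{i. x i \<noteq> 0} \<union> {i. y i \<noteq> 0}"]) auto
  done

lift_definition uminus_fin_seq :: "fin_seq \<Rightarrow> fin_seq" is "\<lambda>x i. - x i" by simp

lift_definition scaleR_fin_seq :: "real \<Rightarrow> fin_seq \<Rightarrow> fin_seq" is "\<lambda>c x i. c * x i"
  subgoal for c x by (rule finite_subset[of _ "{i. x i \<noteq> 0}"]) auto
  done

instance
  by standard (transfer; simp add: algebra_simps)+

end

instantiation fin_seq :: real_inner
begin

definition inner_fin_seq :: "fin_seq \<Rightarrow> fin_seq \<Rightarrow> real"
  where "inner_fin_seq x y = (\<Sum>i | coord x i \<noteq> 0. coord x i * coord y i)"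

definition norm_fin_seq :: "fin_seq \<Rightarrow> real"
  where "norm_fin_seq x = sqrt (inner x x)"

definition dist_fin_seq :: "fin_seq \<Rightarrow> fin_seq \<Rightarrow> real"
  where "dist_fin_seq x y = norm (x - y)"

definition sgn_fin_seq :: "fin_seq \<Rightarrow> fin_seq"
  where "sgn_fin_seq x = x /\<^sub>R norm x"

definition uniformity_fin_seq :: "(fin_seq \<times> fin_seq) filter"
  where "uniformity_fin_seq = (INF e\<in>{0<..}. principal {(x, y). dist x y < e})"

definition open_fin_seq :: "fin_seq set \<Rightarrow> bool"
  where "open_fin_seq U \<longleftrightarrow> (\<forall>x\<in>U. eventually (\<lambda>(x', y). x' = x \<longrightarrow> y \<in> U) uniformity)"

lemma finite_coord: "finite {i. coord x i \<noteq> 0}"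
  using coord[of x] by simp

lemma inner_fin_seq_superset:
  assumes "finite S" "{i. coord x i \<noteq> 0} \<subseteq> S"
  shows "inner x y = (\<Sum>i\<in>S. coord x i * coord y i)"
  unfolding inner_fin_seq_def by (rule sum.mono_neutral_left) (use assms in auto)

instance
proof
  fix x y z :: fin_seq and r :: real
  let ?S = "{i. coord x i \<noteq> 0} \<union> {i. coord y i \<noteq> 0}"
  have fin: "finite ?S" using finite_coord by simp
  show "dist x y = norm (x - y)" by (rule dist_fin_seq_def)
  show "sgn x = x /\<^sub>R norm x" by (rule sgn_fin_seq_def)
  show "uniformity = (INF e\<in>{0<..}. principal {(x, y :: fin_seq). dist x y < e})"
    by (rule uniformity_fin_seq_def)
  show "open U \<longleftrightarrow> (\<forall>x\<in>U. eventually (\<lambda>(x', y). x' = x \<longrightarrow> y \<in> U) uniformity)"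
    for U :: "fin_seq set" by (rule open_fin_seq_def)
  have "inner x y = (\<Sum>i\<in>?S. coord x i * coord y i)"
    by (rule inner_fin_seq_superset[OF fin]) auto
  moreover have "inner y x = (\<Sum>i\<in>?S. coord y i * coord x i)"
    by (rule inner_fin_seq_superset[OF fin]) auto
  ultimately show "inner x y = inner y x" by (simp add: mult.commute)
  have "inner x z = (\<Sum>i\<in>?S. coord x i * coord z i)"
    by (rule inner_fin_seq_superset[OF fin]) auto
  moreover have "inner y z = (\<Sum>i\<in>?S. coord y i * coord z i)"
    by (rule inner_fin_seq_superset[OF fin]) auto
  moreover have "inner (x + y) z = (\<Sum>i\<in>?S. coord (x + y) i * coord z i)"
    by (rule inner_fin_seq_superset[OF fin]) (auto simp: plus_fin_seq.rep_eq)
  ultimately show "inner (x + y) z = inner x z + inner y z"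
    by (simp add: plus_fin_seq.rep_eq sum.distrib algebra_simps)
  have "inner (r *\<^sub>R x) y = (\<Sum>i\<in>?S. coord (r *\<^sub>R x) i * coord y i)"
    by (rule inner_fin_seq_superset[OF fin]) (auto simp: scaleR_fin_seq.rep_eq)
  moreover have "inner x y = (\<Sum>i\<in>?S. coord x i * coord y i)"
    by (rule inner_fin_seq_superset[OF fin]) auto
  ultimately show "inner (r *\<^sub>R x) y = r * inner x y"
    by (simp add: scaleR_fin_seq.rep_eq sum_distrib_left algebra_simps)
  show "0 \<le> inner x x" unfolding inner_fin_seq_def by (rule sum_nonneg) simp
  show "inner x x = 0 \<longleftrightarrow> x = 0"
  proof -
    have "inner x x = 0 \<longleftrightarrow> (\<forall>i\<in>{i. coord x i \<noteq> 0}. coord x i * coord x i = 0)"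
      unfolding inner_fin_seq_def by (rule sum_nonneg_eq_0_iff) (auto simp: finite_coord)
    also have "\<dots> \<longleftrightarrow> coord x = coord 0"
      by (auto simp: zero_fin_seq.rep_eq fun_eq_iff)
    finally show ?thesis by (simp add: coord_inject)
  qed
  show "norm x = sqrt (inner x x)" by (rule norm_fin_seq_def)
qed

end

lemma isometric_embedding_fin_seq:
  fixes W :: "'w::real_inner set"
  assumes "finite B" "W = span B"
  shows "\<exists>f :: 'w \<Rightarrow> fin_seq. linear f \<and> (\<forall>x\<in>W. \<forall>y\<in>W. f x \<bullet> f y = x \<bullet> y)"
proof -
  obtain C where C: "finite C" "span C = W" "pairwise orthogonal C"
    using basis_orthogonal[OF assms(1)] assms(2) by metis
  obtain h where h: "bij_betw h {..<card C} C"
    using ex_bij_betw_nat_finite[OF C(1)] by (auto simp: atLeast0LessThan)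
  define f :: "'w \<Rightarrow> fin_seq"
    where "f x = Fin_seq (\<lambda>i. if i < card C then x \<bullet> sgn (h i) else 0)" for x
  have coord_f: "coord (f x) i = (if i < card C then x \<bullet> sgn (h i) else 0)" for x i
  proof -
    have "finite {i. (if i < card C then x \<bullet> sgn (h i) else 0) \<noteq> 0}"
      by (rule finite_subset[of _ "{..<card C}"]) auto
    then show ?thesis unfolding f_def by (subst Fin_seq_inverse) auto
  qed
  have inner_f: "f x \<bullet> f y = (\<Sum>c\<in>C. (x \<bullet> sgn c) * (y \<bullet> sgn c))" for x y
  proof -
    have "f x \<bullet> f y = (\<Sum>i<card C. coord (f x) i * coord (f y) i)"
      by (rule inner_fin_seq_superset) (auto simp: coord_f split: if_splits)
    also have "\<dots> = (\<Sum>i<card C. (x \<bullet> sgn (h i)) * (y \<bullet> sgn (h i)))"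
      by (simp add: coord_f)
    also have "\<dots> = (\<Sum>c\<in>C. (x \<bullet> sgn c) * (y \<bullet> sgn c))"
      by (rule sum.reindex_bij_betw[OF h])
    finally show ?thesis .
  qed
  have lin: "linear f"
    by (rule linearI; rule coord_inject[THEN iffD1])
      (auto simp: coord_f plus_fin_seq.rep_eq scaleR_fin_seq.rep_eq inner_add_left)
  have expand: "x = (\<Sum>c\<in>C. (x \<bullet> sgn c) *\<^sub>R sgn c)" if x: "x \<in> span C" for x
    using x
  proof (induction rule: span_induct_alt)
    case base
    then show ?case by simp
  next
    case (step a b y)
    have "(b \<bullet> sgn c) *\<^sub>R sgn c = (if c = b then b else 0)" if "c \<in> C" for c
    proof (cases "c = b")
      case True
      then show ?thesis
        by (cases "b = 0") (auto simp: sgn_div_norm dot_square_norm power2_eq_square mult.assoc)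
    next
      case False
      then have "b \<bullet> c = 0"
        using C(3) step.hyps that by (auto simp: pairwise_def orthogonal_def)
      then show ?thesis using False by (simp add: sgn_div_norm)
    qed
    then have b: "(\<Sum>c\<in>C. (b \<bullet> sgn c) *\<^sub>R sgn c) = b"
      using C(1) step.hyps by simp
    have "(\<Sum>c\<in>C. ((a *\<^sub>R b + y) \<bullet> sgn c) *\<^sub>R sgn c)
        = a *\<^sub>R (\<Sum>c\<in>C. (b \<bullet> sgn c) *\<^sub>R sgn c) + (\<Sum>c\<in>C. (y \<bullet> sgn c) *\<^sub>R sgn c)"
      by (simp add: inner_add_left scaleR_add_left sum.distrib scaleR_right.sum)
    then show ?case using step.IH b by simp
  qed
  have "f x \<bullet> f y = x \<bullet> y" if "x \<in> W" "y \<in> W" for x y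
  proof -
    have "x \<bullet> y = (\<Sum>c\<in>C. (x \<bullet> sgn c) *\<^sub>R sgn c) \<bullet> y"
      using expand that C(2) by metis
    also have "\<dots> = f x \<bullet> f y"
      by (simp add: inner_f inner_sum_left inner_commute[of y])
    finally show ?thesis by simp
  qed
  with lin show ?thesis by blast
qed

text \<open>
  An orthogonal representation of the group \<open>G\<close>, topologised by \<open>T\<close>, on the finite-dimensional
  inner product space \<open>V\<close> (a subspace of an arbitrary real inner product space).
  The inner product is preserved by polarisation. As required by \<^const>\<open>group_action\<close>,
  the value of \<open>\<rho> g\<close> outside \<open>V\<close> is \<^const>\<open>undefined\<close>.
\<close>

definition orthogonal_rep ::
    "('g, 'm) monoid_scheme \<Rightarrow> 'g topology \<Rightarrow> 'v::real_inner set \<Rightarrow> ('g \<Rightarrow> 'v \<Rightarrow> 'v) \<Rightarrow> bool"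
  where "orthogonal_rep G T V \<rho> \<longleftrightarrow>
    subspace V \<and> (\<exists>B. finite B \<and> V = span B) \<and>
    group_action G V \<rho> \<and>
    (\<forall>g\<in>carrier G. \<forall>x\<in>V. \<forall>y\<in>V. \<rho> g (x + y) = \<rho> g x + \<rho> g y) \<and>
    (\<forall>g\<in>carrier G. \<forall>x\<in>V. \<forall>c. \<rho> g (c *\<^sub>R x) = c *\<^sub>R \<rho> g x) \<and>
    (\<forall>g\<in>carrier G. \<forall>x\<in>V. norm (\<rho> g x) = norm x) \<and>
    continuous_map (prod_topology T (top_of_set V)) (top_of_set V) (\<lambda>(g, x). \<rho> g x)"

definition fixed_space :: "'g set \<Rightarrow> 'v set \<Rightarrow> ('g \<Rightarrow> 'v \<Rightarrow> 'v) \<Rightarrow> 'v set"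
  where "fixed_space N V \<rho> = {x \<in> V. \<forall>n\<in>N. \<rho> n x = x}"

definition equivariant_isometric_embedding ::
    "'g set \<Rightarrow> 'w::real_inner set \<Rightarrow> ('g \<Rightarrow> 'w \<Rightarrow> 'w) \<Rightarrow>
      'v::real_inner set \<Rightarrow> ('g \<Rightarrow> 'v \<Rightarrow> 'v) \<Rightarrow> ('w \<Rightarrow> 'v) \<Rightarrow> bool"
  where "equivariant_isometric_embedding N W \<sigma> V \<rho> f \<longleftrightarrow>
    f \<in> W \<rightarrow> V \<and>
    (\<forall>x\<in>W. \<forall>y\<in>W. f (x + y) = f x + f y) \<and>
    (\<forall>x\<in>W. \<forall>c. f (c *\<^sub>R x) = c *\<^sub>R f x) \<and>
    (\<forall>x\<in>W. norm (f x) = norm x) \<and>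
    (\<forall>n\<in>N. \<forall>x\<in>W. f (\<sigma> n x) = \<rho> n (f x))"

text \<open>
  The definition makes sense for every topological group; for a compact Lie group \<open>G\<close> it is the
  usual notion. The first argument is the type of inner product spaces in which the
  \<open>N\<close>-representations \<open>W\<close> live; a theorem with this type left variable covers all of them.
  The restriction of the \<open>G\<close>-representation \<open>(V, \<rho>)\<close> along the inclusion of \<open>N\<close> is again given by
  \<open>V\<close> and \<open>\<rho>\<close>. The map induced on fixed spaces is linear, so bijectivity makes it an isomorphism.
\<close>

definition orthogonally_final ::
    "'w::real_inner itself \<Rightarrow> ('g, 'm) monoid_scheme \<Rightarrow> 'g topology \<Rightarrow> 'g set \<Rightarrow> bool"
  where "orthogonally_final _ G T N \<longleftrightarrow>
    N \<lhd> G \<and> closedin T N \<and>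
    (\<forall>(W :: 'w set) \<sigma>.
      orthogonal_rep (G\<lparr>carrier := N\<rparr>) (subtopology T N) W \<sigma> \<longrightarrow>
      (\<exists>(V :: fin_seq set) \<rho> f.
        orthogonal_rep G T V \<rho> \<and>
        equivariant_isometric_embedding N W \<sigma> V \<rho> f \<and>
        bij_betw f (fixed_space N W \<sigma>) (fixed_space N V \<rho>)))"

definition quotient_topology :: "'a topology \<Rightarrow> ('a \<Rightarrow> 'b) \<Rightarrow> 'b topology"
  where "quotient_topology X p =
    topology (\<lambda>U. U \<subseteq> p ` topspace X \<and> openin X {x \<in> topspace X. p x \<in> U})"

lemma openin_quotient_topology:
  "openin (quotient_topology X p) U \<longleftrightarrow>
    U \<subseteq> p ` topspace X \<and> openin X {x \<in> topspace X. p x \<in> U}"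
proof -
  let ?L = "\<lambda>U. U \<subseteq> p ` topspace X \<and> openin X {x \<in> topspace X. p x \<in> U}"
  have "istopology ?L"
    unfolding istopology_def
  proof (intro conjI allI impI)
    fix S T assume "?L S" "?L T"
    moreover have "{x \<in> topspace X. p x \<in> S \<inter> T}
        = {x \<in> topspace X. p x \<in> S} \<inter> {x \<in> topspace X. p x \<in> T}"
      by auto
    ultimately show "S \<inter> T \<subseteq> p ` topspace X" "openin X {x \<in> topspace X. p x \<in> S \<inter> T}"
      by auto
  next
    fix \<K> assume K: "\<forall>K\<in>\<K>. ?L K"
    then show "\<Union>\<K> \<subseteq> p ` topspace X" by blast
    have "{x \<in> topspace X. p x \<in> \<Union>\<K>} = (\<Union>K\<in>\<K>. {x \<in> topspace X. p x \<in> K})"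
      by auto
    with K show "openin X {x \<in> topspace X. p x \<in> \<Union>\<K>}" by auto
  qed
  then show ?thesis unfolding quotient_topology_def by simp
qed

lemma topspace_quotient_topology: "topspace (quotient_topology X p) = p ` topspace X"
proof
  show "topspace (quotient_topology X p) \<subseteq> p ` topspace X"
    using openin_quotient_topology[of X p] openin_topspace by blast
  have "{x \<in> topspace X. p x \<in> p ` topspace X} = topspace X" by auto
  then have "openin (quotient_topology X p) (p ` topspace X)"
    by (simp add: openin_quotient_topology)
  then show "p ` topspace X \<subseteq> topspace (quotient_topology X p)"
    by (rule openin_subset)
qed

lemma quotient_map_quotient_topology: "quotient_map X (quotient_topology X p) p"
  unfolding quotient_map_def topspace_quotient_topology
  by (auto simp: openin_quotient_topology)

definition real_space_group :: "nat \<Rightarrow> (nat \<Rightarrow> real) monoid"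
  where "real_space_group n =
    \<lparr>carrier = topspace (Euclidean_space n), mult = (\<lambda>x y i. x i + y i), one = (\<lambda>_. 0)\<rparr>"

definition integer_lattice :: "nat \<Rightarrow> (nat \<Rightarrow> real) set"
  where "integer_lattice n = {x \<in> topspace (Euclidean_space n). \<forall>i. x i \<in> \<int>}"

definition torus :: "nat \<Rightarrow> (nat \<Rightarrow> real) set monoid"
  where "torus n = real_space_group n Mod integer_lattice n"

definition torus_topology :: "nat \<Rightarrow> (nat \<Rightarrow> real) set topology"
  where "torus_topology n =
    quotient_topology (Euclidean_space n) (r_coset (real_space_group n) (integer_lattice n))"

lemma comm_group_real_space_group: "comm_group (real_space_group n)"
proof (rule comm_groupI)
  fix x assume "x \<in> carrier (real_space_group n)"
  then show "\<exists>y\<in>carrier (real_space_group n). y \<otimes>\<^bsub>real_space_group n\<^esub> x = \<one>\<^bsub>real_space_group n\<^esub>"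
    by (intro bexI[of _ "\<lambda>i. - x i"]) (auto simp: real_space_group_def topspace_Euclidean_space)
qed (auto simp: real_space_group_def topspace_Euclidean_space algebra_simps)

lemma subgroup_integer_lattice: "subgroup (integer_lattice n) (real_space_group n)"
proof -
  interpret comm_group "real_space_group n" by (rule comm_group_real_space_group)
  have inv: "inv\<^bsub>real_space_group n\<^esub> x = (\<lambda>i. - x i)" if "x \<in> carrier (real_space_group n)" for x
    by (rule inv_equality)
      (use that in \<open>auto simp: real_space_group_def topspace_Euclidean_space\<close>)
  show ?thesis
  proof (rule subgroupI)
    show "integer_lattice n \<subseteq> carrier (real_space_group n)"
      by (auto simp: integer_lattice_def real_space_group_def)
    show "integer_lattice n \<noteq> {}"
      by (auto simp: integer_lattice_def topspace_Euclidean_space intro!: exI[of _ "\<lambda>_. 0"])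
    fix a assume a: "a \<in> integer_lattice n"
    then have "a \<in> carrier (real_space_group n)"
      by (auto simp: integer_lattice_def real_space_group_def)
    with a show "inv\<^bsub>real_space_group n\<^esub> a \<in> integer_lattice n"
      by (auto simp: inv integer_lattice_def topspace_Euclidean_space)
    fix b assume "b \<in> integer_lattice n"
    with a show "a \<otimes>\<^bsub>real_space_group n\<^esub> b \<in> integer_lattice n"
      by (auto simp: integer_lattice_def topspace_Euclidean_space real_space_group_def)
  qed
qed

lemma comm_group_torus: "comm_group (torus n)"
  unfolding torus_def
  using comm_group.abelian_FactGroup comm_group_real_space_group subgroup_integer_lattice by blast

lemma topspace_torus_topology: "topspace (torus_topology n) = carrier (torus n)"
  unfolding torus_topology_def torus_def topspace_quotient_topology carrier_FactGroup
  by (simp add: real_space_group_def)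

text \<open>Homomorphisms between Lie groups are understood to be continuous.\<close>

definition isogeny ::
    "('g, 'm) monoid_scheme \<Rightarrow> 'g topology \<Rightarrow> ('h, 'k) monoid_scheme \<Rightarrow> 'h topology \<Rightarrow>
      ('g \<Rightarrow> 'h) \<Rightarrow> bool"
  where "isogeny G S H T \<phi> \<longleftrightarrow>
    \<phi> \<in> epi G H \<and> continuous_map S T \<phi> \<and> finite (kernel G H \<phi>)"

end

theory Submission
  imports Defs
begin

text \<open>
  For a unitary character \<open>\<xi>\<close> of \<open>G\<close>, the twisted sum \<open>S\<^sub>\<xi> w = (\<Sum>g\<in>N. cnj (\<xi> g) \<sigma> g w)\<close>, with values
  in the complexification of \<open>W\<close>, satisfies \<open>S\<^sub>\<xi> (\<sigma> h w) = \<xi> h S\<^sub>\<xi> w\<close>. It is thus \<open>N\<close>-linear if \<open>G\<close> acts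
  on the target by scalar multiplication with \<open>\<xi>\<close>, and this target has no nonzero \<open>N\<close>-fixed
  vectors unless \<open>\<xi>\<close> is trivial on \<open>N\<close>. If finitely many characters satisfy the orthogonality
  relation \<open>(\<Sum>k\<in>K. \<xi>\<^sub>k g) = 0\<close> for all \<open>g \<noteq> 1\<close> in \<open>N\<close>, Parseval's identity makes the suitably scaled
  sum of all \<open>S\<^sub>\<xi>\<close> an isometric embedding. The characters trivial on \<open>N\<close> all give the orbit sum,
  so they are merged into a single summand \<open>W\<^sup>N\<close> with trivial action, which becomes the whole fixed
  space. If \<open>\<zeta>\<^sub>1, \<dots>, \<zeta>\<^sub>r\<close> separate the points of \<open>N\<close>, the monomials in the \<open>\<zeta>\<^sub>i\<close> with exponents below
  \<open>card N\<close> satisfy the orthogonality relation, because their sum is a product of geometric sums.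
  On the torus, the coordinate characters \<open>exp (2\<pi>i x\<^sub>j)\<close> separate points.
\<close>

section \<open>Orthogonal representations: pointwise laws, transport, products\<close>

text \<open>Later proofs cite these facts by position: 4 closure, 5 identity, 6 multiplicativity, 7
  and 8 linearity, 9 isometry, 10 joint continuity.\<close>

lemma orthogonal_repD:
  assumes "orthogonal_rep G T V \<rho>"
  shows "subspace V" "\<exists>B. finite B \<and> V = span B" "group G"
    and "\<And>g x. g \<in> carrier G \<Longrightarrow> x \<in> V \<Longrightarrow> \<rho> g x \<in> V"
    and "\<And>x. x \<in> V \<Longrightarrow> \<rho> \<one>\<^bsub>G\<^esub> x = x"
    and "\<And>g h x. g \<in> carrier G \<Longrightarrow> h \<in> carrier G \<Longrightarrow> x \<in> V \<Longrightarrow> \<rho> (g \<otimes>\<^bsub>G\<^esub> h) x = \<rho> g (\<rho> h x)"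
    and "\<And>g x y. g \<in> carrier G \<Longrightarrow> x \<in> V \<Longrightarrow> y \<in> V \<Longrightarrow> \<rho> g (x + y) = \<rho> g x + \<rho> g y"
    and "\<And>g x c. g \<in> carrier G \<Longrightarrow> x \<in> V \<Longrightarrow> \<rho> g (c *\<^sub>R x) = c *\<^sub>R \<rho> g x"
    and "\<And>g x. g \<in> carrier G \<Longrightarrow> x \<in> V \<Longrightarrow> norm (\<rho> g x) = norm x"
    and "continuous_map (prod_topology T (top_of_set V)) (top_of_set V) (\<lambda>(g, x). \<rho> g x)"
proof -
  have act: "group_action G V \<rho>"
    using assms by (simp add: orthogonal_rep_def)
  interpret group_action G V \<rho> by (rule act)
  show "group G" by (rule group_hom[THEN group_hom.axioms(1)])
  show "subspace V" "\<exists>B. finite B \<and> V = span B"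
    "\<And>g x y. g \<in> carrier G \<Longrightarrow> x \<in> V \<Longrightarrow> y \<in> V \<Longrightarrow> \<rho> g (x + y) = \<rho> g x + \<rho> g y"
    "\<And>g x c. g \<in> carrier G \<Longrightarrow> x \<in> V \<Longrightarrow> \<rho> g (c *\<^sub>R x) = c *\<^sub>R \<rho> g x"
    "\<And>g x. g \<in> carrier G \<Longrightarrow> x \<in> V \<Longrightarrow> norm (\<rho> g x) = norm x"
    "continuous_map (prod_topology T (top_of_set V)) (top_of_set V) (\<lambda>(g, x). \<rho> g x)"
    using assms by (auto simp: orthogonal_rep_def)
  show "\<rho> g x \<in> V" if "g \<in> carrier G" "x \<in> V" for g x
    using element_image[OF that] by simp
  show "\<rho> \<one>\<^bsub>G\<^esub> x = x" if "x \<in> V" for x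
    using id_eq_one that by (metis restrict_apply)
  show "\<rho> (g \<otimes>\<^bsub>G\<^esub> h) x = \<rho> g (\<rho> h x)"
    if "g \<in> carrier G" "h \<in> carrier G" "x \<in> V" for g h x
    using composition_rule[OF that(3,1,2)] .
qed

text \<open>A formula \<open>\<alpha>\<close> usually makes sense beyond \<open>V\<close>, whereas
  membership in \<open>BijGroup V\<close> demands the value \<open>undefined\<close> there; hence
  the \<open>restrict\<close>. Bijectivity follows from the group laws, and continuity has to be
  checked only into the ambient space.\<close>

lemma orthogonal_rep_restrictI:
  fixes V :: "'v::real_inner set"
  assumes "group G" and T: "topspace T = carrier G"
    and "subspace V" "\<exists>B. finite B \<and> V = span B"
    and closed: "\<And>g x. g \<in> carrier G \<Longrightarrow> x \<in> V \<Longrightarrow> \<alpha> g x \<in> V"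
    and one: "\<And>x. x \<in> V \<Longrightarrow> \<alpha> \<one>\<^bsub>G\<^esub> x = x"
    and mult: "\<And>g h x. g \<in> carrier G \<Longrightarrow> h \<in> carrier G \<Longrightarrow> x \<in> V \<Longrightarrow> \<alpha> (g \<otimes>\<^bsub>G\<^esub> h) x = \<alpha> g (\<alpha> h x)"
    and add: "\<And>g x y. g \<in> carrier G \<Longrightarrow> x \<in> V \<Longrightarrow> y \<in> V \<Longrightarrow> \<alpha> g (x + y) = \<alpha> g x + \<alpha> g y"
    and scale: "\<And>g x c. g \<in> carrier G \<Longrightarrow> x \<in> V \<Longrightarrow> \<alpha> g (c *\<^sub>R x) = c *\<^sub>R \<alpha> g x"
    and norm: "\<And>g x. g \<in> carrier G \<Longrightarrow> x \<in> V \<Longrightarrow> norm (\<alpha> g x) = norm x"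
    and cont: "continuous_map (prod_topology T (top_of_set V)) euclidean (\<lambda>(g, x). \<alpha> g x)"
  shows "orthogonal_rep G T V (\<lambda>g. restrict (\<alpha> g) V)"
proof -
  interpret group G by fact
  have bij: "restrict (\<alpha> g) V \<in> Bij V" if g: "g \<in> carrier G" for g
  proof -
    \<comment> \<open>The inverse group element acts as the inverse map.\<close>
    have "\<alpha> (inv\<^bsub>G\<^esub> g) (\<alpha> g x) = x" "\<alpha> g (\<alpha> (inv\<^bsub>G\<^esub> g) x) = x" if "x \<in> V" for x
      using that g mult[of "inv\<^bsub>G\<^esub> g" g x] mult[of g "inv\<^bsub>G\<^esub> g" x] one by simp_all
    then have "bij_betw (\<alpha> g) V V"
      by (intro bij_betwI[where g = "\<alpha> (inv\<^bsub>G\<^esub> g)"]) (use g closed in auto)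
    then show ?thesis
      by (simp add: Bij_def cong: bij_betw_cong)
  qed
  have "group_action G V (\<lambda>g. restrict (\<alpha> g) V)"
    unfolding group_action_def group_hom_def group_hom_axioms_def
  proof (intro conjI)
    show "group G" by fact
    show "group (BijGroup V)" by (rule group_BijGroup)
    show "(\<lambda>g. restrict (\<alpha> g) V) \<in> hom G (BijGroup V)"
    proof (rule homI)
      show "restrict (\<alpha> g) V \<in> carrier (BijGroup V)" if "g \<in> carrier G" for g
        using bij[OF that] by (simp add: BijGroup_def)
      show "restrict (\<alpha> (g \<otimes>\<^bsub>G\<^esub> h)) V = restrict (\<alpha> g) V \<otimes>\<^bsub>BijGroup V\<^esub> restrict (\<alpha> h) V"
        if "g \<in> carrier G" "h \<in> carrier G" for g h
        using bij that by (auto simp: BijGroup_def compose_def mult closed fun_eq_iff restrict_def)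
    qed
  qed
  moreover have "continuous_map (prod_topology T (top_of_set V)) (top_of_set V)
      (\<lambda>(g, x). restrict (\<alpha> g) V x)"
  proof (rule continuous_map_eq[where f = "\<lambda>(g, x). \<alpha> g x"])
    show "continuous_map (prod_topology T (top_of_set V)) (top_of_set V) (\<lambda>(g, x). \<alpha> g x)"
      using cont closed T by (auto simp: continuous_map_in_subtopology)
  qed (use T in auto)
  ultimately show ?thesis
    using \<open>subspace V\<close> \<open>\<exists>B. finite B \<and> V = span B\<close>
    by (simp add: orthogonal_rep_def subspace_add subspace_scale add scale norm)
qed

lemma subspace_fixed_space:
  assumes "orthogonal_rep G T V \<rho>" "N \<subseteq> carrier G"
  shows "subspace (fixed_space N V \<rho>)"
proof -
  note R = orthogonal_repD[OF assms(1)]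
  have zero: "\<rho> g 0 = 0" if "g \<in> carrier G" for g
    using R(8)[OF that subspace_0[OF R(1)], of 0] by simp
  have N: "g \<in> carrier G" if "g \<in> N" for g
    using assms(2) that ..
  show ?thesis
  proof (rule subspaceI)
    show "0 \<in> fixed_space N V \<rho>"
      unfolding fixed_space_def using subspace_0[OF R(1)] zero[OF N] by blast
    show "x + y \<in> fixed_space N V \<rho>" if "x \<in> fixed_space N V \<rho>" "y \<in> fixed_space N V \<rho>" for x y
      using that N subspace_add[OF R(1)] by (simp add: fixed_space_def R(7))
    show "c *\<^sub>R x \<in> fixed_space N V \<rho>" if "x \<in> fixed_space N V \<rho>" for c x
      using that N subspace_scale[OF R(1)] by (simp add: fixed_space_def R(8))
  qed
qed

text \<open>By equivariance \<open>e x\<close> is fixed iff \<open>e (\<rho> n x) = e x\<close> for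
  all \<open>n\<close>, and injectivity cancels \<open>e\<close>.\<close>

lemma bij_betw_fixed_space:
  assumes e: "bij_betw e V V'" and N: "\<And>n x. n \<in> N \<Longrightarrow> x \<in> V \<Longrightarrow> \<rho> n x \<in> V"
    and equiv: "\<And>n x. n \<in> N \<Longrightarrow> x \<in> V \<Longrightarrow> \<rho>' n (e x) = e (\<rho> n x)"
  shows "bij_betw e (fixed_space N V \<rho>) (fixed_space N V' \<rho>')"
proof (rule bij_betw_subset[OF e])
  show sub: "fixed_space N V \<rho> \<subseteq> V" by (auto simp: fixed_space_def)
  have iff: "e x \<in> fixed_space N V' \<rho>' \<longleftrightarrow> x \<in> fixed_space N V \<rho>" if "x \<in> V" for x
    using that N bij_betwE[OF e] inj_on_eq_iff[OF bij_betw_imp_inj_on[OF e]]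
    by (auto simp: fixed_space_def equiv)
  show "e ` fixed_space N V \<rho> = fixed_space N V' \<rho>'"
  proof (intro equalityI subsetI)
    fix y assume y: "y \<in> fixed_space N V' \<rho>'"
    then have "y \<in> e ` V"
      using bij_betw_imp_surj_on[OF e] by (simp add: fixed_space_def)
    then show "y \<in> e ` fixed_space N V \<rho>"
      using iff y by blast
  qed (use iff sub in blast)
qed

text \<open>Products and complexifications live in product types, while
  \<open>orthogonally_final\<close> asks for a representation inside \<open>fin_seq\<close>.
  Conjugating the action by an isometric embedding moves any representation there.\<close>

lemma orthogonal_rep_fin_seq:
  fixes V :: "'v::real_inner set"
  assumes rep: "orthogonal_rep G T V \<rho>" and T: "topspace T = carrier G"
  obtains V' :: "fin_seq set" and \<rho>' e
  where "orthogonal_rep G T V' \<rho>'" "linear e" "bij_betw e V V'"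
    "\<And>x. x \<in> V \<Longrightarrow> norm (e x) = norm x"
    "\<And>g x. g \<in> carrier G \<Longrightarrow> x \<in> V \<Longrightarrow> \<rho>' g (e x) = e (\<rho> g x)"
proof -
  note R = orthogonal_repD[OF rep]
  obtain B where B: "finite B" "V = span B" using R(2) by blast
  obtain e :: "'v \<Rightarrow> fin_seq" where e: "linear e" "\<And>x y. x \<in> V \<Longrightarrow> y \<in> V \<Longrightarrow> e x \<bullet> e y = x \<bullet> y"
    using isometric_embedding_fin_seq[OF B] by blast
  have ne: "norm (e x) = norm x" if "x \<in> V" for x
    using e(2)[OF that that] by (simp add: norm_eq_sqrt_inner)
  \<comment> \<open>Preservation of distances on \<open>V\<close> yields injectivity of
    \<open>e\<close> as well as continuity of \<open>e\<close> and of its inverse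
    \<open>e'\<close>.\<close>
  have de: "dist (e x) (e y) = dist x y" if "x \<in> V" "y \<in> V" for x y
    using ne[OF subspace_diff[OF R(1) that]] by (simp add: dist_norm linear_diff[OF e(1)])
  have inj: "inj_on e V"
    by (rule inj_onI) (metis de dist_eq_0_iff)
  define e' where "e' = the_inv_into V e"
  have e'e: "e' (e x) = x" if "x \<in> V" for x
    unfolding e'_def by (rule the_inv_into_f_f[OF inj that])
  have ec: "continuous_on V e"
    unfolding continuous_on_iff using de by force
  have e'c: "continuous_on (e ` V) e'"
    unfolding continuous_on_iff using de e'e by force
  let ?\<alpha> = "\<lambda>g y. e (\<rho> g (e' y))"
  have "orthogonal_rep G T (e ` V) (\<lambda>g. restrict (?\<alpha> g) (e ` V))"
  proof (rule orthogonal_rep_restrictI[OF R(3) T])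
    show "subspace (e ` V)" by (rule linear_subspace_image[OF e(1) R(1)])
    show "\<exists>B. finite B \<and> e ` V = span B"
      using B linear_span_image[OF e(1), of B] by (intro exI[of _ "e ` B"]) auto
    have "continuous_map (prod_topology T (top_of_set (e ` V))) (prod_topology T (top_of_set V))
        (\<lambda>(g, y). (g, e' y))"
      using e'c e'e
      by (auto simp: continuous_map_prod_top continuous_map_id[unfolded id_def] continuous_map_in_subtopology
          continuous_map_iff_continuous)
    from continuous_map_compose[OF this R(10)]
    have "continuous_map (prod_topology T (top_of_set (e ` V))) (top_of_set V)
        (\<lambda>(g, y). \<rho> g (e' y))"
      by (simp add: o_def case_prod_unfold)
    from continuous_map_compose[OF this ec[folded continuous_map_iff_continuous]]
    show "continuous_map (prod_topology T (top_of_set (e ` V))) euclidean (\<lambda>(g, y). ?\<alpha> g y)"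
      by (simp add: o_def case_prod_unfold)
    show "?\<alpha> g (x + y) = ?\<alpha> g x + ?\<alpha> g y" if g: "g \<in> carrier G" and xy: "x \<in> e ` V" "y \<in> e ` V" for g x y
    proof -
      obtain u v where uv: "u \<in> V" "x = e u" "v \<in> V" "y = e v" using xy by auto
      then have "e' (x + y) = u + v"
        using e'e[OF subspace_add[OF R(1) uv(1,3)]] by (simp add: linear_add[OF e(1)])
      then show ?thesis
        by (simp add: uv e'e R(7)[OF g uv(1,3)] linear_add[OF e(1)])
    qed
    show "?\<alpha> g (c *\<^sub>R x) = c *\<^sub>R ?\<alpha> g x" if g: "g \<in> carrier G" and x: "x \<in> e ` V" for g x c
    proof -
      obtain u where u: "u \<in> V" "x = e u" using x by auto
      then have "e' (c *\<^sub>R x) = c *\<^sub>R u"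
        using e'e[OF subspace_scale[OF R(1) u(1)]] by (simp add: linear_scale[OF e(1)])
      then show ?thesis
        by (simp add: u e'e R(8)[OF g u(1)] linear_scale[OF e(1)])
    qed
  qed (auto simp: ne e'e R(4-6,9))
  then show thesis
    by (rule that[OF _ e(1) inj_on_imp_bij_betw[OF inj] ne]) (simp_all add: e'e)
qed

lemmas continuous_map_Pair_euclidean =
  continuous_map_pairedI[where X = euclidean and Y = euclidean, unfolded prod_topology_euclidean]

lemma orthogonal_rep_prod:
  fixes V :: "'v::real_inner set" and V' :: "'u::real_inner set"
  assumes rep: "orthogonal_rep G T V \<rho>" "orthogonal_rep G T V' \<rho>'" and T: "topspace T = carrier G"
  shows "orthogonal_rep G T (V \<times> V') (\<lambda>g. restrict (map_prod (\<rho> g) (\<rho>' g)) (V \<times> V'))"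
proof (rule orthogonal_rep_restrictI[OF orthogonal_repD(3)[OF rep(1)] T])
  note R = orthogonal_repD[OF rep(1)] and R' = orthogonal_repD[OF rep(2)]
  show "subspace (V \<times> V')" using R(1) R'(1) by (rule subspace_Times)
  obtain B B' where B: "finite B" "V = span B" "finite B'" "V' = span B'"
    using R(2) R'(2) by (elim exE conjE) (rule that)
  \<comment> \<open>The product is the sum of its two axes, so it is spanned by the copies of
    \<open>B\<close> and \<open>B'\<close> on these axes.\<close>
  have "V \<times> V' = {(x, 0) + (0, y) |x y. x \<in> span B \<and> y \<in> span B'}"
    by (auto simp: B(2,4))
  also have "\<dots> = {x + y |x y. x \<in> (\<lambda>x. (x, 0)) ` span B \<and> y \<in> (\<lambda>y. (0, y)) ` span B'}"
    by blast
  also have "(\<lambda>x. (x, 0::'u)) ` span B = span ((\<lambda>x. (x, 0)) ` B)"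
    by (rule linear_span_image[symmetric]) (auto intro!: linearI)
  also have "(\<lambda>y. (0::'v, y)) ` span B' = span ((\<lambda>y. (0, y)) ` B')"
    by (rule linear_span_image[symmetric]) (auto intro!: linearI)
  finally have "V \<times> V' = span ((\<lambda>x. (x, 0)) ` B \<union> (\<lambda>y. (0, y)) ` B')"
    by (simp only: span_Un)
  moreover have "finite ((\<lambda>x. (x, 0::'u)) ` B \<union> (\<lambda>y. (0::'v, y)) ` B')"
    by (simp add: B(1,3))
  ultimately show "\<exists>B. finite B \<and> V \<times> V' = span B"
    by (intro exI conjI)
  have *: "continuous_map (prod_topology T (top_of_set (V \<times> V'))) (prod_topology T (top_of_set V))
      (\<lambda>(g, x). (g, fst x))"
    "continuous_map (prod_topology T (top_of_set (V \<times> V'))) (prod_topology T (top_of_set V'))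
      (\<lambda>(g, x). (g, snd x))"
    by (auto simp: continuous_map_prod_top continuous_map_id[unfolded id_def] continuous_map_in_subtopology
        continuous_map_iff_continuous intro!: continuous_intros)
  have "continuous_map (prod_topology T (top_of_set (V \<times> V'))) euclidean (\<lambda>(g, x). \<rho> g (fst x))"
    "continuous_map (prod_topology T (top_of_set (V \<times> V'))) euclidean (\<lambda>(g, x). \<rho>' g (snd x))"
    using continuous_map_compose[OF *(1) R(10)] continuous_map_compose[OF *(2) R'(10)]
    by (simp_all add: o_def case_prod_unfold continuous_map_in_subtopology)
  from continuous_map_Pair_euclidean[OF this]
  show "continuous_map (prod_topology T (top_of_set (V \<times> V'))) euclidean
      (\<lambda>(g, x). map_prod (\<rho> g) (\<rho>' g) x)"
    by (simp add: map_prod_def case_prod_unfold)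
  show "norm (map_prod (\<rho> g) (\<rho>' g) x) = norm x" if "g \<in> carrier G" "x \<in> V \<times> V'" for g x
    using that by (auto simp: norm_prod_def R(9) R'(9))
qed (auto simp: orthogonal_repD(4-8)[OF rep(1)] orthogonal_repD(4-8)[OF rep(2)])

section \<open>Scalar multiplication on the complexification\<close>

text \<open>\<open>W \<times> W\<close> stands for the complexification of \<open>W\<close>, the pair \<open>(a, b)\<close> for \<open>a + i b\<close>.\<close>

definition complex_scale :: "complex \<Rightarrow> 'w \<times> 'w \<Rightarrow> 'w::real_inner \<times> 'w"
  where "complex_scale z x =
    (Re z *\<^sub>R fst x - Im z *\<^sub>R snd x, Im z *\<^sub>R fst x + Re z *\<^sub>R snd x)"

lemma complex_scale_simps:
  "complex_scale 1 x = x"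
  "complex_scale z 0 = 0"
  "complex_scale (z * z') x = complex_scale z (complex_scale z' x)"
  "complex_scale z (x + y) = complex_scale z x + complex_scale z y"
  "complex_scale z (c *\<^sub>R x) = c *\<^sub>R complex_scale z x"
  "complex_scale (z - z') x = complex_scale z x - complex_scale z' x"
  by (auto simp: complex_scale_def prod_eq_iff algebra_simps)

lemma norm_complex_scale: "norm (complex_scale z x) = cmod z * norm x"
proof -
  have "(norm (complex_scale z x))\<^sup>2 = (cmod z * norm x)\<^sup>2"
    unfolding power_mult_distrib cmod_power2 unfolding power2_norm_eq_inner
    by (simp add: complex_scale_def inner_prod_def inner_diff inner_add inner_commute
        power2_eq_square algebra_simps)
  then show ?thesis
    by (rule power2_eq_imp_eq) simp_all
qed

lemma complex_scale_sum: "complex_scale z (\<Sum>i\<in>I. f i) = (\<Sum>i\<in>I. complex_scale z (f i))"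
  by (induction I rule: infinite_finite_induct) (simp_all add: complex_scale_simps)

text \<open>The inner product of \<open>W \<times> W\<close> is the real part of the Hermitian
  extension of the inner product of \<open>W\<close>, which explains the conjugate.\<close>

lemma inner_complex_scale_Pair_0:
  "complex_scale z (x, 0) \<bullet> complex_scale z' (y, 0) = Re (cnj z * z') * (x \<bullet> y)"
  by (simp add: complex_scale_def algebra_simps)

section \<open>Unitary characters and the representations they define\<close>

definition unitary_character :: "('g, 'm) monoid_scheme \<Rightarrow> 'g topology \<Rightarrow> ('g \<Rightarrow> complex) \<Rightarrow> bool"
  where "unitary_character G T \<xi> \<longleftrightarrow>
    (\<forall>g\<in>carrier G. \<forall>h\<in>carrier G. \<xi> (g \<otimes>\<^bsub>G\<^esub> h) = \<xi> g * \<xi> h) \<and>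
    (\<forall>g\<in>carrier G. cmod (\<xi> g) = 1) \<and>
    continuous_map T euclidean \<xi>"

lemma unitary_characterD:
  assumes "unitary_character G T \<xi>"
  shows "\<And>g h. g \<in> carrier G \<Longrightarrow> h \<in> carrier G \<Longrightarrow> \<xi> (g \<otimes>\<^bsub>G\<^esub> h) = \<xi> g * \<xi> h"
    and "\<And>g. g \<in> carrier G \<Longrightarrow> cmod (\<xi> g) = 1"
    and "continuous_map T euclidean \<xi>"
  using assms by (auto simp: unitary_character_def)

text \<open>The value at the identity is idempotent, and nonzero because it has modulus 1.\<close>

lemma unitary_character_one:
  assumes "unitary_character G T \<xi>" "group G"
  shows "\<xi> \<one>\<^bsub>G\<^esub> = 1"
proof -
  interpret group G by fact
  have "\<xi> \<one>\<^bsub>G\<^esub> = \<xi> \<one>\<^bsub>G\<^esub> * \<xi> \<one>\<^bsub>G\<^esub>"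
    using unitary_characterD(1)[OF assms(1) one_closed one_closed] by simp
  moreover have "\<xi> \<one>\<^bsub>G\<^esub> \<noteq> 0"
    using unitary_characterD(2)[OF assms(1) one_closed] by auto
  ultimately show ?thesis by simp
qed

lemma unitary_character_trivial: "unitary_character G T (\<lambda>_. 1)"
  by (simp add: unitary_character_def)

lemma unitary_character_mult:
  assumes "unitary_character G T \<xi>" "unitary_character G T \<zeta>"
  shows "unitary_character G T (\<lambda>g. \<xi> g * \<zeta> g)"
proof -
  have "continuous_map T euclidean (\<lambda>g. (\<xi> g, \<zeta> g))"
    using assms by (intro continuous_map_Pair_euclidean unitary_characterD(3))
  moreover have "continuous_map euclidean euclidean (\<lambda>(z, w). z * w :: complex)"
    by (simp add: case_prod_unfold continuous_intros)
  ultimately have "continuous_map T euclidean ((\<lambda>(z, w). z * w) \<circ> (\<lambda>g. (\<xi> g, \<zeta> g)))"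
    by (rule continuous_map_compose)
  then show ?thesis
    using assms by (simp add: unitary_character_def o_def norm_mult)
qed

lemma unitary_character_power:
  "unitary_character G T \<xi> \<Longrightarrow> unitary_character G T (\<lambda>g. \<xi> g ^ k)"
  by (induction k) (simp_all add: unitary_character_trivial unitary_character_mult)

lemma unitary_character_prod:
  "(\<And>i. i \<in> I \<Longrightarrow> unitary_character G T (\<xi> i)) \<Longrightarrow> unitary_character G T (\<lambda>g. \<Prod>i\<in>I. \<xi> i g)"
  by (induction I rule: infinite_finite_induct)
    (simp_all add: unitary_character_trivial unitary_character_mult)

lemma orthogonal_rep_trivial:
  assumes "group G" "topspace T = carrier G" "subspace W" "\<exists>B. finite B \<and> W = span B"
  shows "orthogonal_rep G T W (\<lambda>g. restrict (\<lambda>x. x) W)"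
  by (rule orthogonal_rep_restrictI[OF assms])
    (auto simp: case_prod_unfold intro: continuous_map_into_fulltopology[OF continuous_map_snd])

lemma orthogonal_rep_complex_scale:
  fixes G :: "('g, 'm) monoid_scheme" and W :: "'w::real_inner set" and \<xi> :: "'g \<Rightarrow> complex"
  assumes G: "group G" and T: "topspace T = carrier G"
    and W: "subspace W" "\<exists>B. finite B \<and> W = span B"
    and \<xi>: "unitary_character G T \<xi>"
  shows "orthogonal_rep G T (W \<times> W) (\<lambda>g. restrict (complex_scale (\<xi> g)) (W \<times> W))"
proof (rule orthogonal_rep_restrictI[OF G T])
  \<comment> \<open>The trivial representation on \<open>W\<close> is taken twice so that the
    product lemma supplies the subspace property and finite dimension of
    \<open>W \<times> W\<close>.\<close>
  note triv = orthogonal_rep_trivial[OF G T W]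
  show "subspace (W \<times> W)" "\<exists>B. finite B \<and> W \<times> W = span B"
    using orthogonal_repD(1,2)[OF orthogonal_rep_prod[OF triv triv T]] .
  show "complex_scale (\<xi> g) x \<in> W \<times> W" if "g \<in> carrier G" "x \<in> W \<times> W" for g x
    using that W(1) by (auto simp: complex_scale_def subspace_add subspace_diff subspace_scale)
  let ?X = "prod_topology T (top_of_set (W \<times> W))"
  have c: "continuous_map ?X euclidean (\<lambda>p. \<xi> (fst p))"
    using continuous_map_compose[OF continuous_map_fst unitary_characterD(3)[OF \<xi>]]
    by (simp add: o_def)
  have d: "continuous_map ?X euclidean (\<lambda>p. (\<xi> (fst p), snd p))"
    by (intro continuous_map_Pair_euclidean c continuous_map_into_fulltopology[OF continuous_map_snd])
  have "continuous_on UNIV (\<lambda>(z, x::'w \<times> 'w). complex_scale z x)"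
    by (auto simp: complex_scale_def case_prod_unfold intro!: continuous_intros)
  then have "continuous_map euclidean euclidean (\<lambda>(z, x::'w \<times> 'w). complex_scale z x)"
    by simp
  from continuous_map_compose[OF d this]
  show "continuous_map ?X euclidean (\<lambda>(g, x). complex_scale (\<xi> g) x)"
    by (simp add: o_def case_prod_unfold)
qed (simp_all add: complex_scale_simps unitary_character_one[OF \<xi> G] unitary_characterD(1,2)[OF \<xi>]
    norm_complex_scale)

section \<open>Twisted sums over a finite subgroup and Parseval's identity\<close>

locale finite_subgroup_rep =
  fixes G :: "('g, 'm) monoid_scheme" (structure) and T :: "'g topology" and N :: "'g set"
    and W :: "'w::real_inner set" and \<sigma> :: "'g \<Rightarrow> 'w \<Rightarrow> 'w"
  assumes group: "group G" and topspace: "topspace T = carrier G"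
    and subgroup: "subgroup N G" and finite: "finite N"
    and rep: "orthogonal_rep (G\<lparr>carrier := N\<rparr>) (subtopology T N) W \<sigma>"
begin

sublocale group G by (rule group)

sublocale N: subgroup N G by (rule subgroup)

lemmas W_subspace = orthogonal_repD(1)[OF rep]
  and W_finite_dim = orthogonal_repD(2)[OF rep]
  and \<sigma>_closed = orthogonal_repD(4)[OF rep, simplified]
  and \<sigma>_mult = orthogonal_repD(6)[OF rep, simplified]
  and \<sigma>_add = orthogonal_repD(7)[OF rep, simplified]
  and \<sigma>_scale = orthogonal_repD(8)[OF rep, simplified]
  and \<sigma>_norm = orthogonal_repD(9)[OF rep, simplified]

text \<open>For a character \<open>\<xi>\<close> this is \<open>card N\<close> times the projection
  of \<open>w\<close> onto the \<open>\<xi>\<close>-isotypic part of the complexification of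
  \<open>W\<close>.\<close>

definition twisted_sum :: "('g \<Rightarrow> complex) \<Rightarrow> 'w \<Rightarrow> 'w \<times> 'w"
  where "twisted_sum \<xi> w = (\<Sum>g\<in>N. complex_scale (cnj (\<xi> g)) (\<sigma> g w, 0))"

lemma twisted_sum_in: "w \<in> W \<Longrightarrow> twisted_sum \<xi> w \<in> W \<times> W"
  unfolding twisted_sum_def
  by (intro subspace_sum subspace_Times W_subspace)
    (auto simp: complex_scale_def intro!: subspace_neg subspace_scale subspace_0 W_subspace \<sigma>_closed)

lemma twisted_sum_add:
  assumes "x \<in> W" "y \<in> W"
  shows "twisted_sum \<xi> (x + y) = twisted_sum \<xi> x + twisted_sum \<xi> y"
proof -
  have "complex_scale z (\<sigma> g (x + y), 0) = complex_scale z (\<sigma> g x, 0) + complex_scale z (\<sigma> g y, 0)"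
    if "g \<in> N" for g z
    using that assms by (simp add: \<sigma>_add flip: complex_scale_simps(4))
  then show ?thesis
    by (simp add: twisted_sum_def sum.distrib)
qed

lemma twisted_sum_scale:
  assumes "x \<in> W"
  shows "twisted_sum \<xi> (c *\<^sub>R x) = c *\<^sub>R twisted_sum \<xi> x"
proof -
  have "complex_scale z (\<sigma> g (c *\<^sub>R x), 0) = c *\<^sub>R complex_scale z (\<sigma> g x, 0)"
    if "g \<in> N" for g z
    using that assms by (simp add: \<sigma>_scale flip: complex_scale_simps(5))
  then show ?thesis
    by (simp add: twisted_sum_def scaleR_sum_right)
qed

text \<open>Right translation by \<open>h\<close> permutes \<open>N\<close>, and the extra factor
  \<open>cnj (\<xi> h)\<close> it produces cancels against \<open>\<xi> h\<close>, which has modulus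
  1.\<close>

lemma twisted_sum_equivariant:
  assumes \<xi>: "unitary_character G T \<xi>" and h: "h \<in> N" and w: "w \<in> W"
  shows "twisted_sum \<xi> (\<sigma> h w) = complex_scale (\<xi> h) (twisted_sum \<xi> w)"
proof -
  have bij: "bij_betw (\<lambda>g. g \<otimes> h) N N"
    by (rule bij_betwI[where g = "\<lambda>g. g \<otimes> inv h"]) (use h in \<open>auto simp: m_assoc\<close>)
  have "cmod (\<xi> h) = 1"
    using unitary_characterD(2)[OF \<xi>] h by simp
  then have unit: "\<xi> h * cnj (\<xi> h) = 1"
    by (simp add: complex_mult_cnj cmod_def flip: of_real_add)
  have "complex_scale (\<xi> h) (twisted_sum \<xi> w)
      = (\<Sum>g\<in>N. complex_scale (\<xi> h * cnj (\<xi> g)) (\<sigma> g w, 0))"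
    by (simp add: twisted_sum_def complex_scale_sum complex_scale_simps(3))
  also have "\<dots> = (\<Sum>g\<in>N. complex_scale (\<xi> h * cnj (\<xi> (g \<otimes> h))) (\<sigma> (g \<otimes> h) w, 0))"
    by (rule sum.reindex_bij_betw[OF bij, symmetric])
  also have "\<dots> = twisted_sum \<xi> (\<sigma> h w)"
    unfolding twisted_sum_def
  proof (rule sum.cong[OF refl])
    fix g assume g: "g \<in> N"
    have "\<xi> h * cnj (\<xi> (g \<otimes> h)) = cnj (\<xi> g) * (\<xi> h * cnj (\<xi> h))"
      using g h unitary_characterD(1)[OF \<xi>] by simp
    then show "complex_scale (\<xi> h * cnj (\<xi> (g \<otimes> h))) (\<sigma> (g \<otimes> h) w, 0)
        = complex_scale (cnj (\<xi> g)) (\<sigma> g (\<sigma> h w), 0)"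
      using g h w by (simp add: unit \<sigma>_mult)
  qed
  finally show ?thesis ..
qed

text \<open>Expand the square bilinearly. Since \<open>\<xi> h\<close> has modulus 1, its conjugate
  is its inverse, so the coefficient \<open>\<xi> g * cnj (\<xi> h)\<close> depends only on the
  quotient of \<open>g\<close> and \<open>h\<close>.\<close>

lemma norm_twisted_sum:
  assumes \<xi>: "unitary_character G T \<xi>" and w: "w \<in> W"
  shows "(norm (twisted_sum \<xi> w))\<^sup>2 = (\<Sum>g\<in>N. \<Sum>h\<in>N. Re (\<xi> (g \<otimes> inv h)) * (\<sigma> g w \<bullet> \<sigma> h w))"
proof -
  have "\<xi> g * cnj (\<xi> h) = \<xi> (g \<otimes> inv h)" if "g \<in> N" "h \<in> N" for g h
  proof -
    have "\<xi> g = \<xi> (g \<otimes> inv h) * \<xi> h"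
      using that unitary_characterD(1)[OF \<xi>, of "g \<otimes> inv h" h] by (simp add: m_assoc)
    moreover have "cmod (\<xi> h) = 1"
      using unitary_characterD(2)[OF \<xi>] that by simp
    then have "\<xi> h * cnj (\<xi> h) = 1"
      by (simp add: complex_mult_cnj cmod_def flip: of_real_add)
    ultimately show ?thesis
      by (metis mult.assoc mult.right_neutral)
  qed
  then show ?thesis
    by (subst sum.swap) (simp add: power2_norm_eq_inner twisted_sum_def inner_sum_left inner_sum_right
        inner_complex_scale_Pair_0 cong: sum.cong)
qed

text \<open>
  Parseval's identity. The characters need not be distinct on \<open>N\<close>, so that \<open>card K\<close> replaces the
  usual \<open>card N\<close>.
\<close>

lemma sum_norm_twisted_sum:
  assumes \<xi>: "\<And>k. k \<in> K \<Longrightarrow> unitary_character G T (\<xi> k)"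
    and orth: "\<And>g. g \<in> N \<Longrightarrow> g \<noteq> \<one> \<Longrightarrow> (\<Sum>k\<in>K. \<xi> k g) = 0"
    and w: "w \<in> W"
  shows "(\<Sum>k\<in>K. (norm (twisted_sum (\<xi> k) w))\<^sup>2) = real (card K) * real (card N) * (norm w)\<^sup>2"
proof -
  \<comment> \<open>The orthogonality relation at \<open>g \<otimes> inv h\<close> is a Kronecker
    delta, so only the diagonal of the double sum survives; there each \<open>\<sigma> g\<close>
    preserves the norm.\<close>
  have *: "(\<Sum>k\<in>K. Re (\<xi> k (g \<otimes> inv h))) = (if g = h then real (card K) else 0)"
    if "g \<in> N" "h \<in> N" for g h
  proof (cases "g = h")
    case True
    then show ?thesis
      using that by (simp add: unitary_character_one[OF \<xi> group])
  next
    case False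
    then have "g \<otimes> inv h \<noteq> \<one>"
      using that inv_equality[of g "inv h"] by auto
    then have "(\<Sum>k\<in>K. \<xi> k (g \<otimes> inv h)) = 0"
      using that by (intro orth) auto
    then show ?thesis
      using False by (simp flip: Re_sum)
  qed
  have "(\<Sum>k\<in>K. (norm (twisted_sum (\<xi> k) w))\<^sup>2)
      = (\<Sum>k\<in>K. \<Sum>g\<in>N. \<Sum>h\<in>N. Re (\<xi> k (g \<otimes> inv h)) * (\<sigma> g w \<bullet> \<sigma> h w))"
    using \<xi> w by (simp add: norm_twisted_sum)
  also have "\<dots> = (\<Sum>g\<in>N. \<Sum>h\<in>N. \<Sum>k\<in>K. Re (\<xi> k (g \<otimes> inv h)) * (\<sigma> g w \<bullet> \<sigma> h w))"
    by (subst sum.swap, rule sum.cong[OF refl], rule sum.swap)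
  also have "\<dots> = (\<Sum>g\<in>N. \<Sum>h\<in>N. if g = h then real (card K) * (\<sigma> g w \<bullet> \<sigma> h w) else 0)"
    by (intro sum.cong refl) (simp add: * flip: sum_distrib_right)
  also have "\<dots> = (\<Sum>g\<in>N. real (card K) * (norm w)\<^sup>2)"
    using w by (simp add: finite \<sigma>_norm flip: power2_norm_eq_inner)
  finally show ?thesis by simp
qed

section \<open>Equivariant maps into representations without nonzero fixed vectors\<close>

text \<open>Recording an equivariant linear map by its squared norm \<open>q\<close> turns
  orthogonal direct sums into sums of functions. The targets can then be collected by induction over
  the characters without naming an iterated product type.\<close>

definition fixed_point_free_realization :: "('w \<Rightarrow> real) \<Rightarrow> bool"
  where "fixed_point_free_realization q \<longleftrightarrow>
    (\<exists>(V :: fin_seq set) \<rho> f. orthogonal_rep G T V \<rho> \<and> fixed_space N V \<rho> \<subseteq> {0} \<and>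
      f \<in> W \<rightarrow> V \<and> (\<forall>x\<in>W. \<forall>y\<in>W. f (x + y) = f x + f y) \<and>
      (\<forall>x\<in>W. \<forall>c. f (c *\<^sub>R x) = c *\<^sub>R f x) \<and>
      (\<forall>x\<in>W. (norm (f x))\<^sup>2 = q x) \<and>
      (\<forall>n\<in>N. \<forall>x\<in>W. f (\<sigma> n x) = \<rho> n (f x)))"

text \<open>Here the target may live in any inner product space; composing with an equivariant
  isometry \<open>e\<close> brings it into \<open>fin_seq\<close>.\<close>

lemma fixed_point_free_realizationI:
  fixes V :: "'v::real_inner set"
  assumes V: "orthogonal_rep G T V \<rho>" and fixed: "fixed_space N V \<rho> \<subseteq> {0}"
    and f: "\<And>x. x \<in> W \<Longrightarrow> f x \<in> V"
      "\<And>x y. x \<in> W \<Longrightarrow> y \<in> W \<Longrightarrow> f (x + y) = f x + f y"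
      "\<And>x c. x \<in> W \<Longrightarrow> f (c *\<^sub>R x) = c *\<^sub>R f x"
      "\<And>x. x \<in> W \<Longrightarrow> (norm (f x))\<^sup>2 = q x"
      "\<And>n x. n \<in> N \<Longrightarrow> x \<in> W \<Longrightarrow> f (\<sigma> n x) = \<rho> n (f x)"
  shows "fixed_point_free_realization q"
proof -
  obtain V' :: "fin_seq set" and \<rho>' e
    where e: "orthogonal_rep G T V' \<rho>'" "linear e" "bij_betw e V V'"
      "\<And>x. x \<in> V \<Longrightarrow> norm (e x) = norm x"
      "\<And>g x. g \<in> carrier G \<Longrightarrow> x \<in> V \<Longrightarrow> \<rho>' g (e x) = e (\<rho> g x)"
    using orthogonal_rep_fin_seq[OF V topspace] by metis
  have "bij_betw e (fixed_space N V \<rho>) (fixed_space N V' \<rho>')"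
    by (rule bij_betw_fixed_space[OF e(3)]) (simp_all add: e(5) orthogonal_repD(4)[OF V])
  then have "fixed_space N V' \<rho>' \<subseteq> {0}"
    using image_mono[OF fixed, of e] linear_0[OF e(2)] by (simp add: bij_betw_def)
  then show ?thesis
    unfolding fixed_point_free_realization_def
    using e f by (intro exI[of _ V'] exI[of _ \<rho>'] exI[of _ "e \<circ> f"])
      (auto simp: linear_add linear_scale bij_betw_def)
qed

lemma fixed_point_free_realization_0: "fixed_point_free_realization (\<lambda>_. 0)"
proof (rule fixed_point_free_realizationI[where f = "\<lambda>_. 0"])
  show "orthogonal_rep G T {0::fin_seq} (\<lambda>g. restrict (\<lambda>x. x) {0})"
    by (rule orthogonal_rep_trivial[OF group topspace]) (auto intro: subspace_0 exI[of _ "{}"])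
  show "fixed_space N {0::fin_seq} (\<lambda>g. restrict (\<lambda>x. x) {0}) \<subseteq> {0}"
    by (auto simp: fixed_space_def)
qed simp_all

text \<open>Pair the two maps into the orthogonal product: squared norms add, and a fixed pair has
  fixed components, which vanish.\<close>

lemma fixed_point_free_realization_add:
  assumes "fixed_point_free_realization p" "fixed_point_free_realization q"
  shows "fixed_point_free_realization (\<lambda>x. p x + q x)"
proof -
  obtain V :: "fin_seq set" and \<rho> f
    where V: "orthogonal_rep G T V \<rho>" "fixed_space N V \<rho> \<subseteq> {0}"
      "\<forall>x\<in>W. f x \<in> V"
      "\<forall>x\<in>W. \<forall>y\<in>W. f (x + y) = f x + f y"
      "\<forall>x\<in>W. \<forall>c. f (c *\<^sub>R x) = c *\<^sub>R f x"
      "\<forall>x\<in>W. (norm (f x))\<^sup>2 = p x"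
      "\<forall>n\<in>N. \<forall>x\<in>W. f (\<sigma> n x) = \<rho> n (f x)"
    using assms(1) unfolding fixed_point_free_realization_def Pi_iff by (elim exE conjE) (rule that)
  obtain V' :: "fin_seq set" and \<rho>' f'
    where V': "orthogonal_rep G T V' \<rho>'" "fixed_space N V' \<rho>' \<subseteq> {0}"
      "\<forall>x\<in>W. f' x \<in> V'"
      "\<forall>x\<in>W. \<forall>y\<in>W. f' (x + y) = f' x + f' y"
      "\<forall>x\<in>W. \<forall>c. f' (c *\<^sub>R x) = c *\<^sub>R f' x"
      "\<forall>x\<in>W. (norm (f' x))\<^sup>2 = q x"
      "\<forall>n\<in>N. \<forall>x\<in>W. f' (\<sigma> n x) = \<rho>' n (f' x)"
    using assms(2) unfolding fixed_point_free_realization_def Pi_iff by (elim exE conjE) (rule that)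
  show ?thesis
  proof (rule fixed_point_free_realizationI)
    show "orthogonal_rep G T (V \<times> V') (\<lambda>g. restrict (map_prod (\<rho> g) (\<rho>' g)) (V \<times> V'))"
      by (rule orthogonal_rep_prod[OF V(1) V'(1) topspace])
    show "fixed_space N (V \<times> V') (\<lambda>g. restrict (map_prod (\<rho> g) (\<rho>' g)) (V \<times> V')) \<subseteq> {0}"
      using V(2) V'(2) by (auto simp: fixed_space_def zero_prod_def)
    show "(f x, f' x) \<in> V \<times> V'" if "x \<in> W" for x
      using V(3) V'(3) that by auto
    show "(norm (f x, f' x))\<^sup>2 = p x + q x" if "x \<in> W" for x
      using that by (simp add: norm_prod_def flip: V(6)[rule_format] V'(6)[rule_format])
    show "(f (\<sigma> n x), f' (\<sigma> n x))
        = restrict (map_prod (\<rho> n) (\<rho>' n)) (V \<times> V') (f x, f' x)" if "n \<in> N" "x \<in> W" for n x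
      using that by (simp add: V(3,7) V'(3,7))
  qed (simp_all add: V(4,5) V'(4,5))
qed

lemma fixed_point_free_realization_sum:
  assumes "\<And>k. k \<in> K \<Longrightarrow> fixed_point_free_realization (q k)"
  shows "fixed_point_free_realization (\<lambda>x. \<Sum>k\<in>K. q k x)"
  using assms
  by (induction K rule: infinite_finite_induct)
    (simp_all add: fixed_point_free_realization_0 fixed_point_free_realization_add)

text \<open>The element \<open>h\<close> witnesses that \<open>\<xi>\<close> is nontrivial on
  \<open>N\<close>: a fixed vector is killed by the nonzero scalar \<open>\<xi> h - 1\<close>, hence
  is zero. The factor \<open>c\<close> leaves room for the normalisation in Parseval's
  identity.\<close>

lemma fixed_point_free_realization_twisted_sum:
  assumes \<xi>: "unitary_character G T \<xi>" and h: "h \<in> N" "\<xi> h \<noteq> 1"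
  shows "fixed_point_free_realization (\<lambda>x. c\<^sup>2 * (norm (twisted_sum \<xi> x))\<^sup>2)"
proof (rule fixed_point_free_realizationI)
  let ?\<rho> = "\<lambda>g. restrict (complex_scale (\<xi> g)) (W \<times> W)"
  show rep: "orthogonal_rep G T (W \<times> W) ?\<rho>"
    by (rule orthogonal_rep_complex_scale[OF group topspace W_subspace W_finite_dim \<xi>])
  show "fixed_space N (W \<times> W) ?\<rho> \<subseteq> {0}"
  proof
    fix x assume "x \<in> fixed_space N (W \<times> W) ?\<rho>"
    then have "complex_scale (\<xi> h) x = x"
      using h(1) by (auto simp: fixed_space_def)
    then have "complex_scale (\<xi> h - 1) x = 0"
      by (simp add: complex_scale_simps)
    then have "cmod (\<xi> h - 1) * norm x = 0"
      by (simp flip: norm_complex_scale)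
    then show "x \<in> {0}" using h(2) by simp
  qed
  show "c *\<^sub>R twisted_sum \<xi> x \<in> W \<times> W" if "x \<in> W" for x
    by (rule subspace_scale[OF orthogonal_repD(1)[OF rep] twisted_sum_in[OF that]])
  then show "c *\<^sub>R twisted_sum \<xi> (\<sigma> n x) = ?\<rho> n (c *\<^sub>R twisted_sum \<xi> x)" if "n \<in> N" "x \<in> W" for n x
    using that by (simp add: twisted_sum_equivariant[OF \<xi>] complex_scale_simps(5))
qed (simp_all add: twisted_sum_add twisted_sum_scale scaleR_add_right power_mult_distrib mult.commute)

section \<open>The fixed space and the orbit sum\<close>

lemma fixed_space_subspace: "subspace (fixed_space N W \<sigma>)"
  by (rule subspace_fixed_space[OF rep]) simp

lemma fixed_space_finite_dim: "\<exists>B. finite B \<and> fixed_space N W \<sigma> = span B"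
proof -
  obtain B where B: "finite B" "W = span B" using W_finite_dim by blast
  \<comment> \<open>A basis of the fixed space is finite because it is independent inside the span
    of the finite set \<open>B\<close>.\<close>
  obtain C where C: "C \<subseteq> fixed_space N W \<sigma>" "independent C" "fixed_space N W \<sigma> \<subseteq> span C"
    by (rule maximal_independent_subset)
  have "C \<subseteq> span B" using C(1) B(2) by (auto simp: fixed_space_def)
  then have "finite C" using independent_span_bound[OF B(1) C(2)] by simp
  moreover have "span C \<subseteq> fixed_space N W \<sigma>"
    by (rule span_minimal[OF C(1) fixed_space_subspace])
  ultimately show ?thesis using C(3) by auto
qed

text \<open>This is \<open>card N\<close> times the projection onto the fixed space. It is the real
  part of the twisted sum for the trivial character, so one real copy of the fixed space suffices as
  its target.\<close>

definition orbit_sum :: "'w \<Rightarrow> 'w"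
  where "orbit_sum w = (\<Sum>g\<in>N. \<sigma> g w)"

lemma twisted_sum_trivial:
  assumes "\<And>g. g \<in> N \<Longrightarrow> \<xi> g = 1"
  shows "twisted_sum \<xi> w = (orbit_sum w, 0)"
  using assms by (simp add: twisted_sum_def orbit_sum_def complex_scale_simps(1) sum_prod)

lemma orbit_sum_add: "x \<in> W \<Longrightarrow> y \<in> W \<Longrightarrow> orbit_sum (x + y) = orbit_sum x + orbit_sum y"
  by (simp add: orbit_sum_def \<sigma>_add sum.distrib)

lemma orbit_sum_scale: "x \<in> W \<Longrightarrow> orbit_sum (c *\<^sub>R x) = c *\<^sub>R orbit_sum x"
  by (simp add: orbit_sum_def \<sigma>_scale scaleR_sum_right)

text \<open>This is the equivariance of twisted sums for the constant character 1.\<close>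

lemma orbit_sum_invariant:
  assumes "n \<in> N" "x \<in> W"
  shows "orbit_sum (\<sigma> n x) = orbit_sum x"
  using twisted_sum_equivariant[OF unitary_character_trivial assms]
  by (simp add: twisted_sum_trivial complex_scale_simps(1))

lemma orbit_sum_fixed_space: "x \<in> fixed_space N W \<sigma> \<Longrightarrow> orbit_sum x = real (card N) *\<^sub>R x"
  by (simp add: orbit_sum_def fixed_space_def scaleR_conv_of_real sum_constant_scaleR)

lemma \<sigma>_sum:
  assumes h: "h \<in> N" and x: "\<And>i. i \<in> I \<Longrightarrow> x i \<in> W"
  shows "\<sigma> h (\<Sum>i\<in>I. x i) = (\<Sum>i\<in>I. \<sigma> h (x i))"
proof -
  have zero: "\<sigma> h 0 = 0"
    using \<sigma>_scale[OF h subspace_0[OF W_subspace], of 0] by simp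
  show ?thesis
    using x
  proof (induction I rule: infinite_finite_induct)
    case (insert i I)
    moreover have "(\<Sum>i\<in>I. x i) \<in> W"
      using insert.prems by (intro subspace_sum[OF W_subspace]) simp
    ultimately show ?case by (simp add: \<sigma>_add[OF h])
  qed (simp_all add: zero)
qed

text \<open>Applying \<open>\<sigma> h\<close> to the sum only permutes its terms, by left
  translation on \<open>N\<close>.\<close>

lemma orbit_sum_fixed:
  assumes w: "w \<in> W"
  shows "orbit_sum w \<in> fixed_space N W \<sigma>"
  unfolding fixed_space_def
proof (intro CollectI conjI ballI)
  show "orbit_sum w \<in> W"
    unfolding orbit_sum_def by (rule subspace_sum[OF W_subspace \<sigma>_closed[OF _ w]])
  fix h assume h: "h \<in> N"
  have bij: "bij_betw (\<lambda>g. h \<otimes> g) N N"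
  proof (rule bij_betwI[where g = "\<lambda>g. inv h \<otimes> g"])
    show "inv h \<otimes> (h \<otimes> g) = g" "h \<otimes> (inv h \<otimes> g) = g" if "g \<in> N" for g
      using h that m_assoc[of "inv h" h g] m_assoc[of h "inv h" g] by simp_all
  qed (use h in auto)
  have "\<sigma> h (orbit_sum w) = (\<Sum>g\<in>N. \<sigma> h (\<sigma> g w))"
    unfolding orbit_sum_def by (rule \<sigma>_sum[OF h \<sigma>_closed[OF _ w]])
  also have "\<dots> = (\<Sum>g\<in>N. \<sigma> (h \<otimes> g) w)"
    by (rule sum.cong[OF refl]) (rule \<sigma>_mult[OF h _ w, symmetric])
  also have "\<dots> = orbit_sum w"
    unfolding orbit_sum_def by (rule sum.reindex_bij_betw[OF bij])
  finally show "\<sigma> h (orbit_sum w) = orbit_sum w" .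
qed

section \<open>Assembling the isometric embedding\<close>

theorem extends_orthogonally:
  assumes K: "finite K" "K \<noteq> {}"
    and \<xi>: "\<And>k. k \<in> K \<Longrightarrow> unitary_character G T (\<xi> k)"
    and orth: "\<And>g. g \<in> N \<Longrightarrow> g \<noteq> \<one> \<Longrightarrow> (\<Sum>k\<in>K. \<xi> k g) = 0"
  shows "\<exists>(V :: fin_seq set) \<rho> f. orthogonal_rep G T V \<rho> \<and>
    equivariant_isometric_embedding N W \<sigma> V \<rho> f \<and>
    bij_betw f (fixed_space N W \<sigma>) (fixed_space N V \<rho>)"
proof -
  \<comment> \<open>\<open>K0\<close> collects the characters trivial on \<open>N\<close>. The
    constant \<open>c\<close> normalises the factor \<open>card K * card N\<close> in Parseval's
    identity to 1, and \<open>c0\<close> merges the \<open>card K0\<close> equal contributions of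
    \<open>K0\<close> into one.\<close>
  define K0 where "K0 = {k \<in> K. \<forall>g\<in>N. \<xi> k g = 1}"
  define c where "c = 1 / sqrt (real (card K) * real (card N))"
  define c0 where "c0 = c * sqrt (real (card K0))"
  let ?W0 = "fixed_space N W \<sigma>"
  have "N \<noteq> {}" using N.one_closed by blast
  then have card_N: "real (card N) > 0" using finite by (simp add: card_gt_0_iff)
  have c2: "c\<^sup>2 * (real (card K) * real (card N)) = 1"
    using K card_N by (simp add: c_def power_divide)
  have twisted_K0: "norm (twisted_sum (\<xi> k) w) = norm (orbit_sum w)" if "k \<in> K0" for k w
    using that by (simp add: K0_def twisted_sum_trivial)
  \<comment> \<open>Every character outside \<open>K0\<close> differs from 1 somewhere on
    \<open>N\<close>, so the remaining twisted sums together map into a representation without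
    nonzero fixed vectors.\<close>
  have "fixed_point_free_realization (\<lambda>x. \<Sum>k\<in>K - K0. c\<^sup>2 * (norm (twisted_sum (\<xi> k) x))\<^sup>2)"
  proof (rule fixed_point_free_realization_sum)
    fix k assume "k \<in> K - K0"
    then obtain h where "h \<in> N" "\<xi> k h \<noteq> 1" "k \<in> K" by (auto simp: K0_def)
    then show "fixed_point_free_realization (\<lambda>x. c\<^sup>2 * (norm (twisted_sum (\<xi> k) x))\<^sup>2)"
      using \<xi> by (intro fixed_point_free_realization_twisted_sum)
  qed
  then obtain V :: "fin_seq set" and \<rho> f
    where V: "orthogonal_rep G T V \<rho>" "fixed_space N V \<rho> \<subseteq> {0}"
      "\<forall>x\<in>W. f x \<in> V"
      "\<forall>x\<in>W. \<forall>y\<in>W. f (x + y) = f x + f y"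
      "\<forall>x\<in>W. \<forall>c. f (c *\<^sub>R x) = c *\<^sub>R f x"
      "\<forall>x\<in>W. (norm (f x))\<^sup>2 = (\<Sum>k\<in>K - K0. c\<^sup>2 * (norm (twisted_sum (\<xi> k) x))\<^sup>2)"
      "\<forall>n\<in>N. \<forall>x\<in>W. f (\<sigma> n x) = \<rho> n (f x)"
    unfolding fixed_point_free_realization_def Pi_iff by (elim exE conjE) (rule that)
  define F where "F w = (c0 *\<^sub>R orbit_sum w, f w)" for w
  \<comment> \<open>The first component accounts for \<open>K0\<close> and the second for
    \<open>K - K0\<close>; together they give the full Parseval sum scaled by
    \<open>c\<^sup>2\<close>.\<close>
  have norm_F: "norm (F w) = norm w" if w: "w \<in> W" for w
  proof (rule power2_eq_imp_eq)
    have "(\<Sum>k\<in>K0. (norm (twisted_sum (\<xi> k) w))\<^sup>2) = real (card K0) * (norm (orbit_sum w))\<^sup>2"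
      by (simp add: twisted_K0)
    then have "c0\<^sup>2 * (norm (orbit_sum w))\<^sup>2 = c\<^sup>2 * (\<Sum>k\<in>K0. (norm (twisted_sum (\<xi> k) w))\<^sup>2)"
      by (simp add: c0_def power_mult_distrib)
    moreover have "(norm (F w))\<^sup>2 = c0\<^sup>2 * (norm (orbit_sum w))\<^sup>2 + (norm (f w))\<^sup>2"
      by (simp add: F_def norm_prod_def power_mult_distrib)
    ultimately have "(norm (F w))\<^sup>2 = c\<^sup>2 * ((\<Sum>k\<in>K - K0. (norm (twisted_sum (\<xi> k) w))\<^sup>2)
        + (\<Sum>k\<in>K0. (norm (twisted_sum (\<xi> k) w))\<^sup>2))"
      using w by (simp add: V(6) sum_distrib_left distrib_left)
    also have "\<dots> = c\<^sup>2 * (\<Sum>k\<in>K. (norm (twisted_sum (\<xi> k) w))\<^sup>2)"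
      using sum.subset_diff[of K0 K "\<lambda>k. (norm (twisted_sum (\<xi> k) w))\<^sup>2"] K(1)
      by (simp add: K0_def)
    also have "\<dots> = (norm w)\<^sup>2"
      using c2 by (simp add: sum_norm_twisted_sum[OF \<xi> orth w] flip: mult.assoc)
    finally show "(norm (F w))\<^sup>2 = (norm w)\<^sup>2" .
  qed simp_all
  have F_add: "F (x + y) = F x + F y" if "x \<in> W" "y \<in> W" for x y
    using that by (simp add: V(4) F_def orbit_sum_add scaleR_add_right)
  have F_scale: "F (r *\<^sub>R x) = r *\<^sub>R F x" if "x \<in> W" for r x
    using that by (simp add: V(5) F_def orbit_sum_scale)
  let ?\<tau> = "\<lambda>g. restrict (map_prod (restrict (\<lambda>x. x) ?W0) (\<rho> g)) (?W0 \<times> V)"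
  have U: "orthogonal_rep G T (?W0 \<times> V) ?\<tau>"
    by (intro orthogonal_rep_prod V(1) topspace
        orthogonal_rep_trivial[OF group topspace fixed_space_subspace fixed_space_finite_dim])
  have F_in: "F x \<in> ?W0 \<times> V" if "x \<in> W" for x
    unfolding F_def using that by (intro SigmaI V(3)[rule_format] subspace_scale[OF fixed_space_subspace] orbit_sum_fixed)
  have F_equiv: "F (\<sigma> n x) = ?\<tau> n (F x)" if "n \<in> N" "x \<in> W" for n x
    using F_in[OF that(2)] that by (simp add: F_def V(7) orbit_sum_invariant)
  \<comment> \<open>Equivariance sends fixed vectors to fixed vectors of \<open>V\<close>, where
    only zero is available.\<close>
  have f_W0: "f x = 0" if "x \<in> ?W0" for x
  proof -
    have "f x \<in> fixed_space N V \<rho>"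
      unfolding fixed_space_def
    proof (intro CollectI conjI ballI)
      have x: "x \<in> W" "\<And>n. n \<in> N \<Longrightarrow> \<sigma> n x = x" using that by (simp_all add: fixed_space_def)
      show "f x \<in> V" by (rule V(3)[rule_format, OF x(1)])
      show "\<rho> n (f x) = f x" if "n \<in> N" for n
        using V(7)[rule_format, OF that x(1)] x(2)[OF that] by simp
    qed
    then show ?thesis using V(2) by blast
  qed
  have surj: "\<exists>x\<in>?W0. F x = (v, 0)" if v: "v \<in> ?W0" for v
  proof (cases "v = 0")
    case True
    then show ?thesis using v f_W0[OF v] orbit_sum_fixed_space[OF v] by (intro bexI[of _ v]) (auto simp: F_def)
  next
    case False
    have "v \<in> W" using v by (simp add: fixed_space_def)
    \<comment> \<open>If \<open>c0\<close> vanished, both components of \<open>F v\<close> would be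
      zero for this nonzero fixed \<open>v\<close>, contradicting the isometry property.\<close>
    then have "c0 \<noteq> 0" using norm_F[of v] False f_W0[OF v] by (auto simp: F_def)
    \<comment> \<open>On fixed vectors the orbit sum is multiplication by \<open>card N\<close>, so
      this scalar inverts the first component of \<open>F\<close>.\<close>
    moreover have "F (inverse (c0 * real (card N)) *\<^sub>R v) = (v, 0)" if "c0 \<noteq> 0"
      using that card_N by (simp add: F_scale[OF \<open>v \<in> W\<close>]) (simp add: F_def f_W0[OF v] orbit_sum_fixed_space[OF v] field_simps)
    ultimately show ?thesis
      using subspace_scale[OF fixed_space_subspace v] by (intro bexI)
  qed
  \<comment> \<open>The action is trivial on the first factor and has no nonzero fixed vectors on
    the second.\<close>
  have fixed_U: "fixed_space N (?W0 \<times> V) ?\<tau> = ?W0 \<times> {0}"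
  proof -
    have "fixed_space N V \<rho> = {0}"
      using V(2) subspace_0[OF subspace_fixed_space[OF V(1) N.subset]] by blast
    moreover have "fixed_space N (?W0 \<times> V) ?\<tau> = ?W0 \<times> fixed_space N V \<rho>"
      by (auto simp: fixed_space_def)
    ultimately show ?thesis by simp
  qed
  have bij_F: "bij_betw F ?W0 (fixed_space N (?W0 \<times> V) ?\<tau>)"
    unfolding fixed_U
  proof (rule bij_betw_imageI)
    show "inj_on F ?W0"
    proof (rule inj_onI)
      fix x y assume xy: "x \<in> ?W0" "y \<in> ?W0" "F x = F y"
      then have W: "x \<in> W" "y \<in> W" by (simp_all add: fixed_space_def)
      then have d: "x - y \<in> W" by (rule subspace_diff[OF W_subspace])
      have "F x = F (x - y) + F y"
        using F_add[OF d W(2)] by simp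
      then have "norm (x - y) = 0"
        unfolding norm_F[OF d, symmetric] using xy(3) by simp
      then show "x = y" by simp
    qed
    show "F ` ?W0 = ?W0 \<times> {0}"
    proof (intro equalityI subsetI)
      fix p assume "p \<in> F ` ?W0"
      then obtain x where x: "x \<in> ?W0" "p = F x" by blast
      then have "x \<in> W" by (simp add: fixed_space_def)
      from F_in[OF this] show "p \<in> ?W0 \<times> {0}"
        using x f_W0 by (simp add: F_def)
    next
      fix p assume "p \<in> ?W0 \<times> {0::fin_seq}"
      then have "fst p \<in> ?W0" "p = (fst p, 0)" by (auto simp: prod_eq_iff)
      then show "p \<in> F ` ?W0"
        using surj[of "fst p"] by (metis imageI)
    qed
  qed
  \<comment> \<open>The target \<open>?W0 \<times> V\<close> is moved into \<open>fin_seq\<close>;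
    its fixed space travels along.\<close>
  obtain V' :: "fin_seq set" and \<rho>' e
    where e: "orthogonal_rep G T V' \<rho>'" "linear e" "bij_betw e (?W0 \<times> V) V'"
      "\<And>x. x \<in> ?W0 \<times> V \<Longrightarrow> norm (e x) = norm x"
      "\<And>g x. g \<in> carrier G \<Longrightarrow> x \<in> ?W0 \<times> V \<Longrightarrow> \<rho>' g (e x) = e (?\<tau> g x)"
    using orthogonal_rep_fin_seq[OF U topspace] by metis
  have "bij_betw e (fixed_space N (?W0 \<times> V) ?\<tau>) (fixed_space N V' \<rho>')"
  proof (rule bij_betw_fixed_space[OF e(3)])
    fix n x assume n: "n \<in> N" and x: "x \<in> ?W0 \<times> V"
    show "?\<tau> n x \<in> ?W0 \<times> V" by (rule orthogonal_repD(4)[OF U N.mem_carrier[OF n] x])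
    show "\<rho>' n (e x) = e (?\<tau> n x)" by (rule e(5)[OF N.mem_carrier[OF n] x])
  qed
  with bij_F have "bij_betw (e \<circ> F) ?W0 (fixed_space N V' \<rho>')"
    by (rule bij_betw_trans)
  moreover have "equivariant_isometric_embedding N W \<sigma> V' \<rho>' (e \<circ> F)"
    unfolding equivariant_isometric_embedding_def
  proof (intro conjI ballI allI)
    show "e \<circ> F \<in> W \<rightarrow> V'"
      using e(3) F_in by (auto simp: bij_betw_def)
    show "(e \<circ> F) (\<sigma> n x) = \<rho>' n ((e \<circ> F) x)" if "n \<in> N" "x \<in> W" for n x
      using F_equiv[OF that] e(5)[OF _ F_in[OF that(2)]] that(1) by simp
  qed (simp_all add: F_add F_scale linear_add[OF e(2)] linear_scale[OF e(2)] e(4)[OF F_in] norm_F)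
  ultimately show ?thesis
    using e(1) by (intro exI conjI)
qed

end

section \<open>Finite normal subgroups whose points are separated by characters\<close>

text \<open>Left translation by \<open>g\<close> permutes \<open>N\<close>, so it preserves the
  product of all values of \<open>\<xi>\<close> on \<open>N\<close> while multiplying it by
  \<open>\<xi> g ^ card N\<close>. This product is nonzero and cancels.\<close>

lemma unitary_character_power_card:
  assumes \<xi>: "unitary_character G T \<xi>" and G: "group G" and N: "subgroup N G" "finite N"
    and g: "g \<in> N"
  shows "\<xi> g ^ card N = 1"
proof -
  interpret group G by fact
  interpret N: subgroup N G by fact
  have bij: "bij_betw (\<lambda>h. g \<otimes>\<^bsub>G\<^esub> h) N N"
  proof (rule bij_betwI[where g = "\<lambda>h. inv\<^bsub>G\<^esub> g \<otimes>\<^bsub>G\<^esub> h"])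
    show "inv\<^bsub>G\<^esub> g \<otimes>\<^bsub>G\<^esub> (g \<otimes>\<^bsub>G\<^esub> h) = h" "g \<otimes>\<^bsub>G\<^esub> (inv\<^bsub>G\<^esub> g \<otimes>\<^bsub>G\<^esub> h) = h" if "h \<in> N" for h
      using g that m_assoc[of "inv\<^bsub>G\<^esub> g" g h] m_assoc[of g "inv\<^bsub>G\<^esub> g" h] by simp_all
  qed (use g in auto)
  have "(\<Prod>h\<in>N. \<xi> h) = (\<Prod>h\<in>N. \<xi> (g \<otimes>\<^bsub>G\<^esub> h))"
    by (rule prod.reindex_bij_betw[OF bij, symmetric])
  also have "\<dots> = \<xi> g ^ card N * (\<Prod>h\<in>N. \<xi> h)"
    using g by (simp add: unitary_characterD(1)[OF \<xi>] prod.distrib)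
  finally have "\<xi> g ^ card N * (\<Prod>h\<in>N. \<xi> h) = 1 * (\<Prod>h\<in>N. \<xi> h)" by simp
  moreover have "\<xi> h \<noteq> 0" if "h \<in> N" for h
    using unitary_characterD(2)[OF \<xi>, of h] that by auto
  then have "(\<Prod>h\<in>N. \<xi> h) \<noteq> 0"
    using N(2) by simp
  ultimately show ?thesis
    by (simp only: mult_cancel_right simp_thms)
qed

theorem orthogonally_final_finite:
  fixes G :: "('g, 'm) monoid_scheme"
  assumes T: "topspace T = carrier G" and N: "N \<lhd> G" "closedin T N" "finite N"
    and I: "finite I" and \<zeta>: "\<And>i. i \<in> I \<Longrightarrow> unitary_character G T (\<zeta> i)"
    and separating: "\<And>g. g \<in> N \<Longrightarrow> (\<And>i. i \<in> I \<Longrightarrow> \<zeta> i g = 1) \<Longrightarrow> g = \<one>\<^bsub>G\<^esub>"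
  shows "orthogonally_final TYPE('w::real_inner) G T N"
  unfolding orthogonally_final_def
proof (intro conjI allI impI)
  fix W :: "'w set" and \<sigma>
  assume rep: "orthogonal_rep (G\<lparr>carrier := N\<rparr>) (subtopology T N) W \<sigma>"
  interpret normal N G by fact
  interpret finite_subgroup_rep G T N W \<sigma>
    by unfold_locales (rule T N(3) rep)+
  \<comment> \<open>The exponents of the monomials run from 0 to \<open>card N - 1\<close>, so each
    factor sums over \<open>card N\<close> consecutive powers of a \<open>card N\<close>-th root of
    unity.\<close>
  let ?K = "PiE I (\<lambda>_. {..<card N})" and ?\<xi> = "\<lambda>k g. \<Prod>i\<in>I. \<zeta> i g ^ k i"
  show "\<exists>(V :: fin_seq set) \<rho> f. orthogonal_rep G T V \<rho> \<and>
    equivariant_isometric_embedding N W \<sigma> V \<rho> f \<and>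
    bij_betw f (fixed_space N W \<sigma>) (fixed_space N V \<rho>)"
  proof (rule extends_orthogonally)
    show "finite ?K" using I by (intro finite_PiE) auto
    have "N \<noteq> {}" using subgroup.one_closed[OF subgroup_axioms] by blast
    then have "card N > 0" using N(3) by (simp add: card_gt_0_iff)
    then show "?K \<noteq> {}" by (auto simp: PiE_eq_empty_iff)
    show "unitary_character G T (?\<xi> k)" for k
      by (intro unitary_character_prod unitary_character_power \<zeta>)
    fix g assume g: "g \<in> N" "g \<noteq> \<one>\<^bsub>G\<^esub>"
    then obtain i where i: "i \<in> I" "\<zeta> i g \<noteq> 1" using separating by blast
    \<comment> \<open>By distributivity the sum factors over \<open>I\<close>; the factor at the
      separating index \<open>i\<close> is a geometric sum with ratio different from 1, hence
      zero.\<close>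
    have "(\<Sum>k\<in>?K. ?\<xi> k g) = (\<Prod>i\<in>I. \<Sum>j<card N. \<zeta> i g ^ j)"
      using I by (intro prod_sum_PiE[symmetric]) auto
    also have "\<dots> = 0"
    proof (rule prod_zero[OF I bexI[OF _ i(1)]])
      show "(\<Sum>j<card N. \<zeta> i g ^ j) = 0"
        using unitary_character_power_card[OF \<zeta>[OF i(1)] is_group subgroup_axioms N(3) g(1)] i(2)
        by (simp add: geometric_sum)
    qed
    finally show "(\<Sum>k\<in>?K. ?\<xi> k g) = 0" .
  qed
qed (fact N)+

section \<open>Coordinate characters on the torus\<close>

text \<open>Points of the torus are cosets, so a representative is chosen;
  \<open>coordinate_character_r_coset\<close> shows that the choice does not matter. On the torus of
  dimension \<open>n\<close> an index \<open>i \<ge> n\<close> gives the trivial character, since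
  that coordinate vanishes.\<close>

definition coordinate_character :: "nat \<Rightarrow> (nat \<Rightarrow> real) set \<Rightarrow> complex"
  where "coordinate_character i A = cis (2 * pi * (SOME x. x \<in> A) i)"

lemma normal_integer_lattice: "integer_lattice n \<lhd> real_space_group n"
  using comm_group.normal_iff_subgroup[OF comm_group_real_space_group] subgroup_integer_lattice by blast

lemma coordinate_character_r_coset:
  assumes "x \<in> topspace (Euclidean_space n)"
  shows "coordinate_character i (integer_lattice n #>\<^bsub>real_space_group n\<^esub> x) = cis (2 * pi * x i)"
proof -
  let ?A = "integer_lattice n #>\<^bsub>real_space_group n\<^esub> x"
  have A: "?A = {\<lambda>i. l i + x i |l. l \<in> integer_lattice n}"
    by (auto simp: r_coset_def real_space_group_def)
  have "(\<lambda>_. 0) \<in> integer_lattice n"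
    by (simp add: integer_lattice_def topspace_Euclidean_space)
  then have "?A \<noteq> {}" unfolding A by blast
  then have "(SOME y. y \<in> ?A) \<in> ?A" by (simp add: some_in_eq)
  \<comment> \<open>The chosen representative differs from \<open>x\<close> by a lattice vector
    \<open>l\<close>, whose integral coordinates contribute full turns.\<close>
  then obtain l where l: "l \<in> integer_lattice n" "(SOME y. y \<in> ?A) = (\<lambda>i. l i + x i)"
    unfolding A by blast
  have "cis (2 * pi * (l i + x i)) = cis (2 * pi * l i) * cis (2 * pi * x i)"
    by (simp add: cis_mult distrib_left)
  moreover have "cis (2 * pi * l i) = 1"
    using l(1) by (simp add: integer_lattice_def)
  ultimately show ?thesis
    by (simp add: coordinate_character_def l(2))
qed

lemma torusE:
  assumes "A \<in> carrier (torus n)"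
  obtains x where "x \<in> topspace (Euclidean_space n)" "A = integer_lattice n #>\<^bsub>real_space_group n\<^esub> x"
  using assms by (auto simp: torus_def carrier_FactGroup real_space_group_def)

lemma continuous_map_Euclidean_space_coordinate:
  "continuous_map (Euclidean_space n) euclidean (\<lambda>x. x i)"
  unfolding Euclidean_space_def
  by (intro continuous_map_from_subtopology continuous_map_product_coordinates) simp

lemma unitary_character_coordinate:
  "unitary_character (torus n) (torus_topology n) (coordinate_character i)"
  unfolding unitary_character_def
proof (intro conjI ballI)
  fix A assume "A \<in> carrier (torus n)"
  show "cmod (coordinate_character i A) = 1" by (simp add: coordinate_character_def)
next
  fix A B assume "A \<in> carrier (torus n)" "B \<in> carrier (torus n)"
  then obtain x y where
    x: "x \<in> topspace (Euclidean_space n)" "A = integer_lattice n #>\<^bsub>real_space_group n\<^esub> x" and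
    y: "y \<in> topspace (Euclidean_space n)" "B = integer_lattice n #>\<^bsub>real_space_group n\<^esub> y"
    by (elim torusE)
  have "A \<otimes>\<^bsub>torus n\<^esub> B = integer_lattice n #>\<^bsub>real_space_group n\<^esub> (\<lambda>i. x i + y i)"
    using normal.rcos_sum[OF normal_integer_lattice, of x n y] x y
    by (simp add: torus_def real_space_group_def)
  moreover have "(\<lambda>i. x i + y i) \<in> topspace (Euclidean_space n)"
    using x y by (simp add: topspace_Euclidean_space)
  ultimately show "coordinate_character i (A \<otimes>\<^bsub>torus n\<^esub> B)
      = coordinate_character i A * coordinate_character i B"
    using x y by (simp add: coordinate_character_r_coset cis_mult distrib_left)
next
  \<comment> \<open>By the universal property of the quotient topology it is enough that the lift to
    Euclidean space is continuous, and this lift is \<open>cis (2 * pi * x i)\<close>.\<close>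
  have "continuous_on UNIV (\<lambda>t. cis (2 * pi * t))"
    by (intro continuous_intros)
  then have "continuous_map euclideanreal euclidean (\<lambda>t. cis (2 * pi * t))" by simp
  from continuous_map_compose[OF continuous_map_Euclidean_space_coordinate this]
  have "continuous_map (Euclidean_space n) euclidean
      (coordinate_character i \<circ> r_coset (real_space_group n) (integer_lattice n))"
    by (rule continuous_map_eq) (simp add: coordinate_character_r_coset)
  then show "continuous_map (torus_topology n) euclidean (coordinate_character i)"
    unfolding torus_topology_def
    by (rule continuous_compose_quotient_map[OF quotient_map_quotient_topology])
qed

text \<open>Triviality forces the first \<open>n\<close> coordinates of a representative to be
  integers, and all others are zero; the representative lies in the lattice, so its coset is the
  identity.\<close>

lemma coordinate_characters_separate:
  assumes A: "A \<in> carrier (torus n)" and triv: "\<And>i. i < n \<Longrightarrow> coordinate_character i A = 1"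
  shows "A = \<one>\<^bsub>torus n\<^esub>"
proof -
  interpret comm_group "real_space_group n" by (rule comm_group_real_space_group)
  obtain x where x: "x \<in> topspace (Euclidean_space n)" "A = integer_lattice n #>\<^bsub>real_space_group n\<^esub> x"
    using A by (rule torusE)
  have "x i \<in> \<int>" for i
  proof (cases "i < n")
    case True
    then have "cos (2 * pi * x i) = 1"
      using triv[OF True] x by (simp add: coordinate_character_r_coset complex_eq_iff)
    then obtain k :: int where "2 * pi * x i = of_int k * 2 * pi"
      by (auto simp: cos_one_2pi_int)
    then show ?thesis by simp
  qed (use x in \<open>simp add: topspace_Euclidean_space\<close>)
  then have "x \<in> integer_lattice n"
    using x(1) by (simp add: integer_lattice_def)
  then show ?thesis
    using coset_join2[OF _ subgroup_integer_lattice, of x] x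
    by (simp add: torus_def real_space_group_def)
qed

text \<open>By separation the identity is the common zero set of the conditions that a coordinate
  character equals 1, each of which is closed by continuity.\<close>

lemma closedin_torus_one: "closedin (torus_topology n) {\<one>\<^bsub>torus n\<^esub>}"
proof -
  interpret comm_group "torus n" by (rule comm_group_torus)
  have eq: "{\<one>\<^bsub>torus n\<^esub>} = (\<Inter>i. {A \<in> topspace (torus_topology n). coordinate_character i A \<in> {1}})"
    using coordinate_characters_separate unitary_character_one[OF unitary_character_coordinate is_group]
    by (auto simp: topspace_torus_topology)
  show ?thesis
    unfolding eq
    by (intro closedin_INT closedin_continuous_map_preimage[OF unitary_characterD(3)[OF unitary_character_coordinate]])
      auto
qed

text \<open>The kernel is a finite closed normal subgroup, and the first \<open>n\<close> coordinate
  characters separate its points from the identity, so the criterion for finite subgroups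
  applies.\<close>

theorem lemma6p3p1:
  fixes n :: nat
    and \<phi> :: "(nat \<Rightarrow> real) set \<Rightarrow> (nat \<Rightarrow> real) set"
    and N :: "(nat \<Rightarrow> real) set set"
  assumes "isogeny (torus n) (torus_topology n) (torus n) (torus_topology n) \<phi>"
    and "N = kernel (torus n) (torus n) \<phi>"
  shows "orthogonally_final TYPE('w::real_inner) (torus n) (torus_topology n) N"
proof (rule orthogonally_final_finite[where I = "{..<n}" and \<zeta> = coordinate_character])
  have \<phi>: "\<phi> \<in> hom (torus n) (torus n)"
      "continuous_map (torus_topology n) (torus_topology n) \<phi>"
      "finite (kernel (torus n) (torus n) \<phi>)"
    using assms(1) by (auto simp: isogeny_def epi_def)
  have "group (torus n)" using comm_group_torus by (rule comm_group.axioms(2))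
  then interpret group_hom "torus n" "torus n" \<phi>
    using \<phi>(1) by (simp add: group_hom_def group_hom_axioms_def)
  show "N \<lhd> torus n" using normal_kernel assms(2) by simp
  show "finite N" using \<phi>(3) assms(2) by simp
  \<comment> \<open>The kernel is the preimage of the closed identity under the continuous map
    \<open>\<phi>\<close>.\<close>
  show "closedin (torus_topology n) N"
    using closedin_continuous_map_preimage[OF \<phi>(2) closedin_torus_one]
    by (simp add: assms(2) kernel_def topspace_torus_topology)
  show "A = \<one>\<^bsub>torus n\<^esub>" if "A \<in> N" "\<And>i. i \<in> {..<n} \<Longrightarrow> coordinate_character i A = 1" for A
    using that coordinate_characters_separate[of A n] by (simp add: assms(2) kernel_def)
qed (simp_all add: topspace_torus_topology unitary_character_coordinate)

end
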